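(* Let $K$ be an algebraically closed field of characteristic different from $2$, $g>1$ an integer, $\alpha_1,\dots,\alpha_{2g+1}$ distinct elements of $K$, $\mathcal{C}$ the smooth projective model of $y^2=\prod_{i=1}^{2g+1}(x-\alpha_i)$, and $J$ its jacobian, with $\mathcal{C}$ embedded in $J$ so that $\infty\mapsto 0$. Let $\mathcal{C}_{1/2}:=2^{-1}\mathcal{C}\subset J$ be the preimage of $\mathcal{C}$ under multiplication by $2$ in $J$, and let $\Theta\subset J$ be the theta divisor. Then the intersection of $\mathcal{C}_{1/2}(K)$ and $\Theta$ consists of points of order dividing $2$ on $J$. In particular, the intersection of $\mathcal{C}$ and $\mathcal{C}_{1/2}$ consists of $\infty$ and all the points $\mathfrak{W}_i=(\alpha_i,0)$, $1\le i\le 2g+1$. In other words, $$\mathcal{C}\cap 2\cdot\Theta=\{0\}.$$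
   Context: The curve $\mathcal{C}$ is a genus $g$ hyperelliptic curve with exactly one point at infinity, denoted $\infty$. A point $P\in\mathcal{C}(K)$ is identified with the linear equivalence class $\mathrm{cl}((P)-(\infty))\in J(K)$; this is the embedding of $\mathcal{C}$ in $J$. For a positive integer $d\le g$, $\Theta_d\subset J$ is the image of the regular map $\mathcal{C}^d\to J$, $(Q_1,\dots,Q_d)\mapsto\sum_{i=1}^dQ_i$ (sum in $J$); it is an irreducible closed $d$-dimensional subvariety. The theta divisor is $\Theta:=\Theta_{g-1}$. $2\cdot\Theta$ denotes the image of $\Theta$ under multiplication by $2$ in $J$. *)

theory Defs
  imports
    "HOL-Computational_Algebra.Polynomial_Factorial"
    "HOL-Algebra.Multiplicative_Group"
    "HOL-Algebra.Free_Abelian_Groups"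
begin

section \<open>The curve y^2 = f(x)\<close>

text \<open>
  Throughout, \<open>f\<close> is meant to be a separable polynomial of odd degree over an algebraically closed
  field of characteristic other than 2. The affine curve is then smooth, and its smooth projective
  model has exactly one further point.
\<close>

datatype 'a point = Infty | Aff 'a 'a

definition curve :: "'a::field poly \<Rightarrow> 'a point set" where
  "curve f = insert Infty {Aff a b | a b. b ^ 2 = poly f a}"

text \<open>
  The function field \<open>K(x)[Y] / (Y^2 - f(x))\<close>: the pair \<open>(u, v)\<close> stands for \<open>u + v y\<close>.
\<close>

definition function_field :: "'a::field poly \<Rightarrow> ('a poly fract \<times> 'a poly fract) ring" where
  "function_field f =
    \<lparr>carrier = UNIV,
     monoid.mult = (\<lambda>(u, v) (u', v'). (u * u' + v * v' * to_fract f, u * v' + v * u')),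
     monoid.one = (1, 0),
     ring.zero = (0, 0),
     ring.add = (\<lambda>(u, v) (u', v'). (u + u', v + v'))\<rparr>"

definition const_fn :: "'a::field \<Rightarrow> 'a poly fract \<times> 'a poly fract" where
  "const_fn c = (to_fract [:c:], 0)"

definition x_fn :: "'a::field poly fract \<times> 'a poly fract" where
  "x_fn = (to_fract [:0, 1:], 0)"

definition y_fn :: "'a::field poly fract \<times> 'a poly fract" where
  "y_fn = (0, 1)"


section \<open>Order of vanishing\<close>

text \<open>
  Normalized discrete valuations of a field \<open>F\<close> that are trivial on the subfield \<open>k\<close>. They are only
  defined on nonzero elements; the value at zero is pinned to \<open>undefined\<close> so that equality of
  valuations is equality of functions.
\<close>

definition discrete_valuation ::
    "('b, 'm) ring_scheme \<Rightarrow> 'b set \<Rightarrow> ('b \<Rightarrow> int) \<Rightarrow> bool" where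
  "discrete_valuation F k v \<longleftrightarrow>
     v \<in> extensional (carrier F - {\<zero>\<^bsub>F\<^esub>}) \<and>
     v ` (carrier F - {\<zero>\<^bsub>F\<^esub>}) = UNIV \<and>
     (\<forall>c\<in>k - {\<zero>\<^bsub>F\<^esub>}. v c = 0) \<and>
     (\<forall>s\<in>carrier F - {\<zero>\<^bsub>F\<^esub>}. \<forall>t\<in>carrier F - {\<zero>\<^bsub>F\<^esub>}. v (s \<otimes>\<^bsub>F\<^esub> t) = v s + v t) \<and>
     (\<forall>s\<in>carrier F - {\<zero>\<^bsub>F\<^esub>}. \<forall>t\<in>carrier F - {\<zero>\<^bsub>F\<^esub>}.
        s \<oplus>\<^bsub>F\<^esub> t \<noteq> \<zero>\<^bsub>F\<^esub> \<longrightarrow> min (v s) (v t) \<le> v (s \<oplus>\<^bsub>F\<^esub> t))"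

text \<open>
  A valuation is centered at \<open>(a, b)\<close> if \<open>x - a\<close> and \<open>y - b\<close> lie in its maximal ideal (unless they
  vanish identically, which cannot happen here), and at infinity if \<open>x\<close> has a pole. Each point of
  the smooth projective model is the center of exactly one valuation.
\<close>

fun centered_at ::
    "'a::field poly \<Rightarrow> ('a poly fract \<times> 'a poly fract \<Rightarrow> int) \<Rightarrow> 'a point \<Rightarrow> bool" where
  "centered_at f v Infty \<longleftrightarrow> v x_fn < 0"
| "centered_at f v (Aff a b) \<longleftrightarrow>
     v (x_fn \<ominus>\<^bsub>function_field f\<^esub> const_fn a) > 0 \<and> v (y_fn \<ominus>\<^bsub>function_field f\<^esub> const_fn b) > 0"

definition ord_at ::
    "'a::field poly \<Rightarrow> 'a point \<Rightarrow> 'a poly fract \<times> 'a poly fract \<Rightarrow> int" where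
  "ord_at f P = (THE v. discrete_valuation (function_field f) (range const_fn) v \<and>
                        centered_at f v P)"


section \<open>Divisor classes and the jacobian\<close>

abbreviation divisor_group :: "'a::field poly \<Rightarrow> ('a point \<Rightarrow>\<^sub>0 int) monoid" where
  "divisor_group f \<equiv> free_Abelian_group (curve f)"

definition divisor_degree :: "('a point \<Rightarrow>\<^sub>0 int) \<Rightarrow> int" where
  "divisor_degree D = (\<Sum>P\<in>Poly_Mapping.keys D. Poly_Mapping.lookup D P)"

definition principal_divisors :: "'a::field poly \<Rightarrow> ('a point \<Rightarrow>\<^sub>0 int) set" where
  "principal_divisors f =
    {D \<in> carrier (divisor_group f).
       \<exists>h \<in> carrier (function_field f) - {\<zero>\<^bsub>function_field f\<^esub>}.
         \<forall>P\<in>curve f. Poly_Mapping.lookup D P = ord_at f P h}"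

definition divisor_class :: "'a::field poly \<Rightarrow> ('a point \<Rightarrow>\<^sub>0 int) \<Rightarrow> ('a point \<Rightarrow>\<^sub>0 int) set" where
  "divisor_class f D = principal_divisors f #>\<^bsub>divisor_group f\<^esub> D"

text \<open>
  The group \<open>J(K)\<close> of the linear equivalence classes of divisors of degree 0, inside the full
  divisor class group. It is written multiplicatively, as always in HOL-Algebra: \<open>\<one>\<close> is the zero
  of \<open>J\<close>, and \<open>Q [^] n\<close> is \<open>n Q\<close>.
\<close>

definition jacobian :: "'a::field poly \<Rightarrow> ('a point \<Rightarrow>\<^sub>0 int) set monoid" where
  "jacobian f =
    (divisor_group f Mod principal_divisors f)
      \<lparr>carrier := divisor_class f ` {D \<in> carrier (divisor_group f). divisor_degree D = 0}\<rparr>"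

definition jac_point :: "'a::field poly \<Rightarrow> 'a point \<Rightarrow> ('a point \<Rightarrow>\<^sub>0 int) set" where
  "jac_point f P = divisor_class f (frag_of P - frag_of Infty)"

definition jac_curve :: "'a::field poly \<Rightarrow> ('a point \<Rightarrow>\<^sub>0 int) set set" where
  "jac_curve f = jac_point f ` curve f"

definition doubling :: "'a::field poly \<Rightarrow> ('a point \<Rightarrow>\<^sub>0 int) set \<Rightarrow> ('a point \<Rightarrow>\<^sub>0 int) set" where
  "doubling f Q = Q [^]\<^bsub>jacobian f\<^esub> (2::nat)"

definition half_curve :: "'a::field poly \<Rightarrow> ('a point \<Rightarrow>\<^sub>0 int) set set" where
  "half_curve f = {Q \<in> carrier (jacobian f). doubling f Q \<in> jac_curve f}"

definition Theta :: "'a::field poly \<Rightarrow> nat \<Rightarrow> ('a point \<Rightarrow>\<^sub>0 int) set set" where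
  "Theta f d =
    {\<Otimes>\<^bsub>jacobian f\<^esub>i\<in>{1..d}. jac_point f (Q i) | Q. Q \<in> {1..d} \<rightarrow> curve f}"

end

theory Submission
  imports Defs
begin

text \<open>
  Suppose \<open>Q = P\<^sub>1 + \<dots> + P\<^sub>d\<close> with \<open>d = g - 1\<close> and \<open>2 Q = P\<close> in the jacobian, where \<open>P = (a, b)\<close> is a finite
  point. Then the divisor of some function \<open>h\<close> is \<open>2 (P\<^sub>1 + \<dots> + P\<^sub>d) - P - (2 d - 1) \<infinity>\<close>. The function
  \<open>(x - a) h\<close> has no finite poles and a pole of order at most \<open>2 g - 1\<close> at infinity, whereas \<open>y\<close> has
  a pole of order \<open>2 g + 1\<close> there; hence it is a polynomial in \<open>x\<close>, and its divisor is
  invariant under \<open>y \<mapsto> - y\<close> and even at the branch points. But its order at \<open>(a, - b)\<close> is odd, and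
  if \<open>b \<noteq> 0\<close> its order at \<open>(a, b)\<close> is even: a contradiction. So \<open>2 Q = 0\<close>.

  The orders of functions are made explicit as follows. At infinity and at the branch points the valuation is
  the valuation of \<open>K(x)\<close> applied to the norm \<open>u^2 - t^2 f\<close> of \<open>u + t y\<close>, since
  \<open>f\<close> has odd order there. At \<open>(a, b)\<close> with \<open>b \<noteq> 0\<close> the function \<open>x - a\<close> is a uniformizer.
\<close>

section \<open>Valuations of the rational function field\<close>

lemma fract_decomp:
  fixes z :: "'a::idom fract"
  obtains p q where "q \<noteq> 0" "z = to_fract p / to_fract q"
  by (cases z) (auto simp: Fract_conv_to_fract)

text \<open>The value is selected over all representations of \<open>z\<close>, so no normal form of
  a fraction enters; \<open>w_quot\<close> shows that the choice does not matter. At zero the value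
  is unspecified.\<close>

definition ratfun_order :: "('a::field poly \<Rightarrow> int) \<Rightarrow> 'a poly fract \<Rightarrow> int" where
  "ratfun_order d z = (THE n. \<exists>p q. p \<noteq> 0 \<and> q \<noteq> 0 \<and> z = to_fract p / to_fract q \<and> n = d p - d q)"

text \<open>Serves both for the order at a point of the line and for minus the degree. The element
  of value 1 is allowed to be a quotient because at infinity no polynomial has positive
  value.\<close>

locale poly_valuation =
  fixes d :: "'a::field poly \<Rightarrow> int"
  assumes d_mult: "\<And>p q. p \<noteq> 0 \<Longrightarrow> q \<noteq> 0 \<Longrightarrow> d (p * q) = d p + d q"
    and d_add: "\<And>p q. p \<noteq> 0 \<Longrightarrow> q \<noteq> 0 \<Longrightarrow> p + q \<noteq> 0 \<Longrightarrow> min (d p) (d q) \<le> d (p + q)"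
    and d_const: "\<And>c. c \<noteq> 0 \<Longrightarrow> d [:c:] = 0"
    and d_unif: "\<exists>p q. p \<noteq> 0 \<and> q \<noteq> 0 \<and> d p - d q = 1"
begin

abbreviation w :: "'a poly fract \<Rightarrow> int" where "w \<equiv> ratfun_order d"

lemma w_quot:
  assumes "p \<noteq> 0" "q \<noteq> 0"
  shows "w (to_fract p / to_fract q) = d p - d q"
  unfolding ratfun_order_def
proof (rule the_equality)
  fix n assume "\<exists>p' q'. p' \<noteq> 0 \<and> q' \<noteq> 0 \<and> to_fract p / to_fract q = to_fract p' / to_fract q' \<and> n = d p' - d q'"
  then obtain p' q' where *: "p' \<noteq> 0" "q' \<noteq> 0" "to_fract p / to_fract q = to_fract p' / to_fract q'"
    "n = d p' - d q'" by blast
  then have "to_fract (p * q') = to_fract (p' * q)"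
    using assms by (simp add: field_simps)
  then have "p * q' = p' * q" by (simp only: to_fract_eq_iff)
  then have "d p + d q' = d p' + d q"
    using assms * by (metis d_mult)
  then show "n = d p - d q" using * by simp
qed (use assms in blast)

lemma w_poly: "p \<noteq> 0 \<Longrightarrow> w (to_fract p) = d p"
  using w_quot[of p 1] d_const[of 1] by (simp flip: one_pCons)

lemma w_mult: 
  assumes "s \<noteq> 0" "t \<noteq> 0"
  shows "w (s * t) = w s + w t"
proof -
  obtain p q p' q' where *: "q \<noteq> 0" "s = to_fract p / to_fract q" "q' \<noteq> 0" "t = to_fract p' / to_fract q'"
    by (metis fract_decomp)
  moreover have "s * t = to_fract (p * p') / to_fract (q * q')"
    using * by simp
  ultimately show ?thesis using assms
    by (simp only: w_quot) (auto simp: w_quot d_mult simp del: to_fract_mult)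
qed

lemma w_add: 
  assumes "s \<noteq> 0" "t \<noteq> 0" "s + t \<noteq> 0"
  shows "min (w s) (w t) \<le> w (s + t)"
proof -
  obtain p q p' q' where *: "q \<noteq> 0" "s = to_fract p / to_fract q" "q' \<noteq> 0" "t = to_fract p' / to_fract q'"
    by (metis fract_decomp)
  then have nz: "p \<noteq> 0" "p' \<noteq> 0" using assms by auto
  have st: "s + t = to_fract (p * q' + p' * q) / to_fract (q * q')"
    using * by (simp add: field_simps)
  then have nz': "p * q' + p' * q \<noteq> 0" using assms by (metis div_0 to_fract_0)
  have "w (s + t) = d (p * q' + p' * q) - d (q * q')"
    unfolding st using nz' * by (intro w_quot) auto
  moreover have "min (d (p * q')) (d (p' * q)) \<le> d (p * q' + p' * q)"
    using nz * nz' by (intro d_add) auto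
  ultimately show ?thesis using nz * 
    by (auto simp: w_quot d_mult)
qed

lemma w_1 [simp]: "w 1 = 0"
  using w_mult[of 1 1] by simp

lemma w_minus1: "w (- 1) = 0"
  using w_mult[of "-1" "-1"] by simp

lemma w_uminus [simp]: "w (- s) = w s"
proof (cases "s = 0")
  case False
  then show ?thesis using w_mult[of "-1" s] w_minus1 by simp
qed simp

lemma w_power: "s \<noteq> 0 \<Longrightarrow> w (s ^ n) = int n * w s"
  by (induction n) (auto simp: w_mult algebra_simps)

lemma w_inverse: "s \<noteq> 0 \<Longrightarrow> w (inverse s) = - w s"
  using w_mult[of s "inverse s"] by simp

lemma w_surj: "\<exists>s. s \<noteq> 0 \<and> w s = n"
proof -
  obtain t where t: "t \<noteq> 0" "w t = 1"
    using d_unif w_quot by (metis divide_eq_0_iff to_fract_eq_0_iff)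
  show ?thesis
  proof (cases "n \<ge> 0")
    case True
    then show ?thesis using t w_power[of t "nat n"]
      by (intro exI[of _ "t ^ nat n"]) auto
  next
    case False
    then show ?thesis using t w_power[of t "nat (-n)"]
      by (intro exI[of _ "inverse (t ^ nat (-n))"]) (auto simp: w_inverse)
  qed
qed

text \<open>The inequality is applied a second time to \<open>s = (s + t) - t\<close>: since
  \<open>w s < w t\<close>, the minimum on its left side can only be
  \<open>w (s + t)\<close>.\<close>

lemma w_add_eq: 
  assumes "s \<noteq> 0" "t \<noteq> 0" "w s < w t"
  shows "s + t \<noteq> 0" "w (s + t) = w s"
proof -
  show nz: "s + t \<noteq> 0"
  proof
    assume "s + t = 0"
    then have "t = - s" by (simp add: eq_neg_iff_add_eq_0 add.commute)
    then show False using assms by simp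
  qed
  have "min (w s) (w t) \<le> w (s + t)" using assms nz w_add by blast
  moreover have "min (w (s + t)) (w (-t)) \<le> w (s + t + - t)"
    using assms nz by (intro w_add) auto
  ultimately show "w (s + t) = w s" using assms by simp
qed

end

section \<open>Orders at the points of the projective line\<close>

definition ord_fin :: "'a::field \<Rightarrow> 'a poly \<Rightarrow> int" where "ord_fin a p = int (Polynomial.order a p)"
definition ord_inf :: "'a::field poly \<Rightarrow> int" where "ord_inf p = - int (degree p)"

lemma order_add_le:
  assumes "p + q \<noteq> (0 :: 'a::field poly)" "p \<noteq> 0" "q \<noteq> 0"
  shows "min (Polynomial.order a p) (Polynomial.order a q) \<le> Polynomial.order a (p + q)"
proof -
  have "[:-a, 1:] ^ min (Polynomial.order a p) (Polynomial.order a q) dvd p + q"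
    using assms by (intro dvd_add) (auto simp: order_divides)
  then show ?thesis using assms by (auto simp: order_divides)
qed

lemma order_linear: "Polynomial.order a [:-a, 1::'a::field:] = 1"
  using order_power_n_n[of a 1] by simp

interpretation fin: poly_valuation "ord_fin a" for a :: "'a::field"
proof
  show mult: "ord_fin a (p * q) = ord_fin a p + ord_fin a q" if "p \<noteq> 0" "q \<noteq> 0" for p q
    using that by (simp add: ord_fin_def order_mult)
  show "min (ord_fin a p) (ord_fin a q) \<le> ord_fin a (p + q)" if "p \<noteq> 0" "q \<noteq> 0" "p + q \<noteq> 0" for p q
    using that order_add_le[of p q a] by (auto simp: ord_fin_def)
  show c: "ord_fin a [:c:] = 0" if "c \<noteq> 0" for c
    using that by (auto simp: ord_fin_def intro: order_0I)
  have "ord_fin a [:-a, 1:] - ord_fin a 1 = 1"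
    by (simp add: ord_fin_def order_linear)
  then show "\<exists>p q. p \<noteq> 0 \<and> q \<noteq> 0 \<and> ord_fin a p - ord_fin a q = 1"
    by (metis one_neq_zero pCons_eq_0_iff)
qed

interpretation inf: poly_valuation "ord_inf :: 'a::field poly \<Rightarrow> int"
proof
  show mult: "ord_inf (p * q) = ord_inf p + ord_inf q" if "p \<noteq> 0" "q \<noteq> 0" for p q :: "'a poly"
    using that by (simp add: ord_inf_def degree_mult_eq)
  show "min (ord_inf p) (ord_inf q) \<le> ord_inf (p + q)" if "p \<noteq> 0" "q \<noteq> 0" "p + q \<noteq> 0" for p q :: "'a poly"
    using degree_add_le_max[of p q] by (auto simp: ord_inf_def)
  show "ord_inf [:c:] = 0" if "c \<noteq> 0" for c :: 'a
    by (simp add: ord_inf_def)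
  have "ord_inf 1 - ord_inf [:0, 1::'a:] = 1"
    by (simp add: ord_inf_def)
  then show "\<exists>p q :: 'a poly. p \<noteq> 0 \<and> q \<noteq> 0 \<and> ord_inf p - ord_inf q = 1"
    by (metis one_neq_zero pCons_eq_0_iff)
qed

abbreviation w_fin :: "'a::field \<Rightarrow> 'a poly fract \<Rightarrow> int" where "w_fin a \<equiv> ratfun_order (ord_fin a)"
abbreviation w_inf :: "'a::field poly fract \<Rightarrow> int" where "w_inf \<equiv> ratfun_order ord_inf"

text \<open>Over an algebraically closed field divisibility can be tested root by root: each root of
  the denominator is also a root of the numerator, and cancelling the common linear factor lowers
  the degree.\<close>

lemma poly_if_w_fin_nonneg:
  fixes z :: "'a::alg_closed_field poly fract"
  assumes "z \<noteq> 0" "\<And>a. w_fin a z \<ge> 0"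
  obtains p where "z = to_fract p"
proof -
  have "q dvd p" if "q \<noteq> 0" "p \<noteq> 0" "\<And>a. Polynomial.order a q \<le> Polynomial.order a p" for p q :: "'a poly"
    using that
  proof (induction "degree q" arbitrary: p q)
    case 0
    then have "is_unit q" by (metis is_unit_iff_degree)
    then show ?case by (simp add: unit_imp_dvd)
  next
    case (Suc n)
    then obtain a where a: "poly q a = 0" using alg_closed_imp_poly_has_root[of q] by auto
    then obtain q1 where q1: "q = [:-a, 1:] * q1" by (metis dvdE poly_eq_0_iff_dvd)
    have "Polynomial.order a q \<noteq> 0" using a Suc.prems order_root by blast
    then have "Polynomial.order a p \<noteq> 0" using Suc.prems(3)[of a] by simp
    then have "poly p a = 0" using order_root by blast
    then obtain p1 where p1: "p = [:-a, 1:] * p1" by (metis dvdE poly_eq_0_iff_dvd)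
    have nz: "q1 \<noteq> 0" "p1 \<noteq> 0" using q1 p1 Suc.prems by auto
    have "degree q = Suc (degree q1)" using nz unfolding q1 by (subst degree_mult_eq) auto
    moreover have "Polynomial.order b q1 \<le> Polynomial.order b p1" for b
      using Suc.prems(3)[of b] order_mult[of "[:-a, 1:]" q1 b] order_mult[of "[:-a, 1:]" p1 b]
        Suc.prems(1,2) unfolding q1 p1 by linarith
    ultimately have "q1 dvd p1" using Suc.hyps(1)[of q1 p1] Suc.hyps(2) nz by simp
    then show ?case unfolding q1 p1 by (intro mult_dvd_mono) auto
  qed
  moreover obtain p q where pq: "q \<noteq> 0" "z = to_fract p / to_fract q" by (metis fract_decomp)
  moreover have "p \<noteq> 0" using assms pq by auto
  moreover have "Polynomial.order a q \<le> Polynomial.order a p" for a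
    using assms(2)[of a] pq \<open>p \<noteq> 0\<close> by (simp add: fin.w_quot ord_fin_def)
  ultimately have "q dvd p" by blast
  then obtain r where "p = q * r" by (auto elim: dvdE)
  then have "z = to_fract r" using pq by simp
  then show ?thesis by (rule that)
qed


section \<open>Valuations of the function field\<close>

lemma function_field_simps [simp]:
  "(u, v) \<otimes>\<^bsub>function_field f\<^esub> (u', v') = (u * u' + v * v' * to_fract f, u * v' + v * u')"
  "(u, v) \<oplus>\<^bsub>function_field f\<^esub> (u', v') = (u + u', v + v')"
  "\<one>\<^bsub>function_field f\<^esub> = (1, 0)"
  "\<zero>\<^bsub>function_field f\<^esub> = (0, 0)"
  "carrier (function_field f) = UNIV"
  by (auto simp: function_field_def)

lemma cring_function_field: "cring (function_field f)"
proof (intro cringI abelian_groupI comm_monoidI)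
  show "\<exists>y\<in>carrier (function_field f). y \<oplus>\<^bsub>function_field f\<^esub> x = \<zero>\<^bsub>function_field f\<^esub>" for x
    by (cases x) (auto intro: exI[of _ "- fst x"] exI[of _ "- snd x"])
qed (auto simp: algebra_simps)

lemma function_field_minus [simp]:
  "(u, v) \<ominus>\<^bsub>function_field f\<^esub> (u', v') = (u - u', v - v')"
proof -
  interpret cring "function_field f" by (rule cring_function_field)
  have "\<ominus>\<^bsub>function_field f\<^esub> (u', v') = (- u', - v')"
    by (rule minus_equality) auto
  then show ?thesis by (simp add: a_minus_def)
qed

text \<open>The hyperelliptic involution acting on functions, that is, the nontrivial automorphism
  of the quadratic extension of \<open>K(x)\<close>.\<close>

definition fconj :: "'a::field poly fract \<times> 'a poly fract \<Rightarrow> 'a poly fract \<times> 'a poly fract" where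
  "fconj h = (fst h, - snd h)"

abbreviation is_valuation where
  "is_valuation f v \<equiv> discrete_valuation (function_field f) (range const_fn) v"

lemma is_valuation_iff:
  "is_valuation f v \<longleftrightarrow>
     v \<in> extensional (- {(0, 0)}) \<and> (\<forall>n. \<exists>h. h \<noteq> (0, 0) \<and> v h = n) \<and>
     (\<forall>c. c \<noteq> 0 \<longrightarrow> v (to_fract [:c:], 0) = 0) \<and>
     (\<forall>s t. s \<noteq> (0, 0) \<longrightarrow> t \<noteq> (0, 0) \<longrightarrow> v (s \<otimes>\<^bsub>function_field f\<^esub> t) = v s + v t) \<and>
     (\<forall>s t. s \<noteq> (0, 0) \<longrightarrow> t \<noteq> (0, 0) \<longrightarrow> s \<oplus>\<^bsub>function_field f\<^esub> t \<noteq> (0, 0) \<longrightarrow>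
        min (v s) (v t) \<le> v (s \<oplus>\<^bsub>function_field f\<^esub> t))"
proof -
  have "v ` (- {(0, 0)}) = UNIV \<longleftrightarrow> (\<forall>n. \<exists>h. h \<noteq> (0, 0) \<and> v h = n)"
  proof -
    have "n \<in> v ` (- {(0, 0)}) \<longleftrightarrow> (\<exists>h. h \<noteq> (0, 0) \<and> v h = n)" for n
      by (simp add: image_iff Bex_def eq_commute[of n] del: split_paired_Ex)
    then show ?thesis by (simp only: set_eq_iff UNIV_I simp_thms)
  qed
  moreover have "(\<forall>c\<in>range const_fn - {(0, 0)}. v c = 0) \<longleftrightarrow> (\<forall>c. c \<noteq> 0 \<longrightarrow> v (to_fract [:c:], 0) = 0)"
    by (auto simp: const_fn_def)
  ultimately show ?thesis
    unfolding discrete_valuation_def by (simp add: Compl_eq_Diff_UNIV [symmetric] Ball_def)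
qed

text \<open>Odd degree and simple roots give \<open>f\<close> odd order at infinity and at each of
  its roots, so exactly one, ramified, point lies over each of these places. Characteristic other
  than 2 keeps \<open>(a, b)\<close> and \<open>(a, - b)\<close> apart for nonzero
  \<open>b\<close>.\<close>

locale odd_curve =
  fixes f :: "'a::alg_closed_field poly"
  assumes odd_deg: "odd (degree f)"
    and simple_roots: "\<And>a. poly f a = 0 \<Longrightarrow> Polynomial.order a f = 1"
    and two_nz: "(2::'a) \<noteq> 0"
begin

lemma f_nz: "f \<noteq> 0"
  using odd_deg by auto

lemma w_inf_f: "w_inf (to_fract f) = - int (degree f)"
  using f_nz by (simp add: inf.w_poly ord_inf_def)

lemma w_fin_f: "w_fin a (to_fract f) = (if poly f a = 0 then 1 else 0)"
  using f_nz simple_roots[of a] by (auto simp: fin.w_poly ord_fin_def order_0I)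

end

text \<open>An arbitrary valuation, not tied to a point. The facts below serve to prove that the
  valuation centered at a given point is unique, and later to compute with
  \<open>ord_at\<close>.\<close>

locale curve_valuation =
  fixes f :: "'a::field poly" and v :: "'a poly fract \<times> 'a poly fract \<Rightarrow> int"
  assumes is_val: "is_valuation f v"
begin

lemma v_mult: "s \<noteq> (0, 0) \<Longrightarrow> t \<noteq> (0, 0) \<Longrightarrow> v (s \<otimes>\<^bsub>function_field f\<^esub> t) = v s + v t"
  using is_val is_valuation_iff by blast

lemma v_add: "s \<noteq> (0, 0) \<Longrightarrow> t \<noteq> (0, 0) \<Longrightarrow> s \<oplus>\<^bsub>function_field f\<^esub> t \<noteq> (0, 0) \<Longrightarrow>
    min (v s) (v t) \<le> v (s \<oplus>\<^bsub>function_field f\<^esub> t)"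
  using is_val is_valuation_iff by blast

lemma v_const: "c \<noteq> 0 \<Longrightarrow> v (to_fract [:c:], 0) = 0"
  using is_val is_valuation_iff by blast

lemma v_surj: "\<exists>h. h \<noteq> (0, 0) \<and> v h = n"
  using is_val is_valuation_iff by blast

lemma v_ext: "v \<in> extensional (- {(0, 0)})"
  using is_val is_valuation_iff by blast

lemma v_mult_rat: "s \<noteq> 0 \<Longrightarrow> t \<noteq> 0 \<Longrightarrow> v (s * t, 0) = v (s, 0) + v (t, 0)"
  using v_mult[of "(s, 0)" "(t, 0)"] by simp

lemma v_one: "v (1, 0) = 0"
  using v_mult[of "(1, 0)" "(1, 0)"] by simp

lemma v_uminus: "v (- s, - t) = v (s, t)"
proof (cases "(s, t) = (0, 0)")
  case False
  have "v (-1, 0) = 0" using v_mult[of "(-1, 0)" "(-1, 0)"] v_one by simp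
  then show ?thesis using v_mult[of "(-1, 0)" "(s, t)"] False by auto
qed auto

lemma v_add_eq:
  assumes "s \<noteq> (0, 0)" "t \<noteq> (0, 0)" "v s < v t"
  shows "s \<oplus>\<^bsub>function_field f\<^esub> t \<noteq> (0, 0)" "v (s \<oplus>\<^bsub>function_field f\<^esub> t) = v s"
proof -
  obtain a b c d where [simp]: "s = (a, b)" "t = (c, d)" by (cases s, cases t)
  show nz: "s \<oplus>\<^bsub>function_field f\<^esub> t \<noteq> (0, 0)"
  proof
    assume "s \<oplus>\<^bsub>function_field f\<^esub> t = (0, 0)"
    then have "c = - a" "d = - b" by (simp_all add: eq_neg_iff_add_eq_0 add.commute)
    then show False using assms v_uminus[of a b] by simp
  qed
  have "min (v s) (v t) \<le> v (s \<oplus>\<^bsub>function_field f\<^esub> t)"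
    using assms nz by (intro v_add) auto
  moreover have "min (v (s \<oplus>\<^bsub>function_field f\<^esub> t)) (v (-c, -d))
      \<le> v ((s \<oplus>\<^bsub>function_field f\<^esub> t) \<oplus>\<^bsub>function_field f\<^esub> (-c, -d))"
    using assms nz by (intro v_add) auto
  ultimately show "v (s \<oplus>\<^bsub>function_field f\<^esub> t) = v s" using assms v_uminus[of c d] by simp
qed

lemma v_power_rat: "s \<noteq> 0 \<Longrightarrow> v (s ^ n, 0) = int n * v (s, 0)"
  by (induction n) (auto simp: v_mult_rat v_one algebra_simps)

lemma v_quot_rat: "s \<noteq> 0 \<Longrightarrow> t \<noteq> 0 \<Longrightarrow> v (s / t, 0) = v (s, 0) - v (t, 0)"
  using v_mult_rat[of "s / t" t] by simp

text \<open>Division by \<open>x - a\<close> leaves a constant remainder, and constants have value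
  0; induction on the degree then applies to the quotient.\<close>

lemma v_poly_nonneg:
  assumes "v (to_fract [:-a, 1:], 0) \<ge> 0" "p \<noteq> 0"
  shows "v (to_fract p, 0) \<ge> 0"
  using assms(2)
proof (induction "degree p" arbitrary: p rule: less_induct)
  case less
  show ?case
  proof (cases "degree p = 0")
    case True
    then obtain c where "p = [:c:]" by (metis degree_0_id)
    then show ?thesis using v_const less by simp
  next
    case False
    define r c where "r = synthetic_div p a" and "c = poly p a"
    have p: "p = [:-a, 1:] * r + [:c:]"
      unfolding r_def c_def using synthetic_div_correct'[of a p] by simp
    have r: "r \<noteq> 0" using False p by auto
    have "degree r < degree p" using False by (simp add: r_def degree_synthetic_div)
    then have "v (to_fract r, 0) \<ge> 0" using r less by blast
    then have 1: "v (to_fract ([:-a, 1:] * r), 0) \<ge> 0"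
      using v_mult_rat[of "to_fract [:-a, 1:]" "to_fract r"] r assms by (simp del: mult_pCons_left)
    \<comment> \<open>A zero remainder is treated apart, since the ultrametric inequality speaks of
      nonzero summands only.\<close>
    show ?thesis
    proof (cases "c = 0")
      case True
      then show ?thesis using 1 p by simp
    next
      case False
      then have "min (v (to_fract ([:-a, 1:] * r), 0)) (v (to_fract [:c:], 0)) \<le>
          v ((to_fract ([:-a, 1:] * r), 0) \<oplus>\<^bsub>function_field f\<^esub> (to_fract [:c:], 0))"
        using r p less.prems by (intro v_add) (simp_all del: mult_pCons_left to_fract_mult to_fract_add add: to_fract_add[symmetric])
      then show ?thesis using 1 v_const[OF False] p
        by (simp del: mult_pCons_left to_fract_mult to_fract_add add: to_fract_add[symmetric])
    qed
  qed
qed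

text \<open>In \<open>p = p(a) + (x - a) r\<close> the second summand has positive value, so the
  nonzero constant \<open>p(a)\<close> dominates.\<close>

lemma v_poly_unit:
  assumes "v (to_fract [:-a, 1:], 0) > 0" "poly p a \<noteq> 0"
  shows "v (to_fract p, 0) = 0"
proof -
  have "p = [:poly p a:] + [:-a, 1:] * synthetic_div p a"
    using synthetic_div_correct'[of a p] by (metis add.commute)
  then obtain r c where p: "p = [:c:] + [:-a, 1:] * r" and c: "c \<noteq> 0"
    using assms(2) by blast
  show ?thesis
  proof (cases "r = 0")
    case True
    then show ?thesis using p c v_const[of c] by simp
  next
    case False
    then have "v (to_fract r, 0) \<ge> 0" using assms v_poly_nonneg[of a r] by simp
    then have "v (to_fract ([:-a, 1:] * r), 0) > 0"
      using v_mult_rat[of "to_fract [:-a, 1:]" "to_fract r"] False assms by (simp del: mult_pCons_left)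
    then show ?thesis
      using v_add_eq(2)[of "(to_fract [:c:], 0)" "(to_fract ([:-a, 1:] * r), 0)"] v_const[of c] False c p
      by (simp del: mult_pCons_left to_fract_mult to_fract_add add: to_fract_add[symmetric])
  qed
qed

text \<open>After the full power of \<open>x - a\<close> is split off, the cofactor is nonzero at
  \<open>a\<close> and has value 0. The factor \<open>v(x - a)\<close> is the ramification index,
  which is still unknown at this stage.\<close>

lemma v_rat_fin:
  assumes "v (to_fract [:-a, 1:], 0) > 0" "s \<noteq> 0"
  shows "v (s, 0) = v (to_fract [:-a, 1:], 0) * w_fin a s"
proof -
  have poly: "v (to_fract p, 0) = v (to_fract [:-a, 1:], 0) * ord_fin a p" if nz: "p \<noteq> 0" for p
  proof -
    define n where "n = Polynomial.order a p"
    obtain q where q: "p = [:-a, 1:] ^ n * q" "\<not> [:-a, 1:] dvd q"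
      using order_decomp[OF nz, of a] n_def by blast
    have "poly q a \<noteq> 0" using q(2) by (simp add: poly_eq_0_iff_dvd)
    then have "q \<noteq> 0" by auto
    have pw: "to_fract (r ^ k) = to_fract r ^ k" for r :: "'a poly" and k
      by (induction k) auto
    have "v (to_fract p, 0) = v (to_fract [:-a, 1:] ^ n * to_fract q, 0)"
      using arg_cong[OF q(1), of to_fract] by (simp only: pw to_fract_mult)
    also have "\<dots> = int n * v (to_fract [:-a, 1:], 0) + v (to_fract q, 0)"
      using \<open>q \<noteq> 0\<close> by (simp add: v_mult_rat v_power_rat)
    finally show ?thesis using v_poly_unit[OF assms(1) \<open>poly q a \<noteq> 0\<close>] by (simp add: ord_fin_def n_def)
  qed
  obtain p q where pq: "q \<noteq> 0" "s = to_fract p / to_fract q" by (metis fract_decomp)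
  then have "p \<noteq> 0" using assms by auto
  then have "v (s, 0) = v (to_fract p, 0) - v (to_fract q, 0)" using pq by (simp add: v_quot_rat)
  then show ?thesis unfolding poly[OF \<open>p \<noteq> 0\<close>] poly[OF \<open>q \<noteq> 0\<close>]
    unfolding pq(2) fin.w_quot[OF \<open>p \<noteq> 0\<close> \<open>q \<noteq> 0\<close>] by (simp add: right_diff_distrib)
qed

text \<open>A polynomial is built up coefficient by coefficient as \<open>x p + c\<close>; the pole
  of \<open>x p\<close> dominates the constant, so only the degree counts. The factor
  \<open>- v(x)\<close> is again the ramification index.\<close>

lemma v_rat_inf:
  assumes "v (to_fract [:0, 1:], 0) < 0" "s \<noteq> 0"
  shows "v (s, 0) = - v (to_fract [:0, 1:], 0) * w_inf s"
proof -
  have poly: "v (to_fract p, 0) = v (to_fract [:0, 1:], 0) * int (degree p)" if "p \<noteq> 0" for p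
    using that
  proof (induction p)
    case (pCons c p)
    have p: "pCons c p = [:0, 1:] * p + [:c:]" by simp
    show ?case
    proof (cases "p = 0")
      case True
      then show ?thesis using pCons v_const[of c] by simp
    next
      case False
      then have "v (to_fract p, 0) = v (to_fract [:0, 1:], 0) * int (degree p)" by (rule pCons.IH)
      then have 1: "v (to_fract ([:0, 1:] * p), 0) = v (to_fract [:0, 1:], 0) * int (degree (pCons c p))"
        using v_mult_rat[of "to_fract [:0, 1:]" "to_fract p"] False
        unfolding to_fract_mult degree_pCons_eq[OF False] by (simp add: algebra_simps)
      have neg: "v (to_fract ([:0, 1:] * p), 0) < 0"
        unfolding 1 using assms False by (simp add: mult_less_0_iff)
      have nz: "to_fract ([:0, 1:] * p) \<noteq> 0" using False by simp
      have "v (to_fract (pCons c p), 0) = v (to_fract ([:0, 1:] * p), 0)"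
      proof (cases "c = 0")
        case c: False
        then have "v (to_fract [:c:], 0) = 0" by (rule v_const)
        then have "v ((to_fract ([:0, 1:] * p), 0) \<oplus>\<^bsub>function_field f\<^esub> (to_fract [:c:], 0))
            = v (to_fract ([:0, 1:] * p), 0)"
          using neg nz c by (intro v_add_eq) auto
        then show ?thesis unfolding p function_field_simps to_fract_add by simp
      qed simp
      then show ?thesis using 1 by simp
    qed
  qed auto
  obtain p q where pq: "q \<noteq> 0" "s = to_fract p / to_fract q" by (metis fract_decomp)
  then have "p \<noteq> 0" using assms by auto
  then have "v (s, 0) = v (to_fract p, 0) - v (to_fract q, 0)" using pq by (simp add: v_quot_rat)
  then show ?thesis unfolding poly[OF \<open>p \<noteq> 0\<close>] poly[OF \<open>q \<noteq> 0\<close>]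
    unfolding pq(2) inf.w_quot[OF \<open>p \<noteq> 0\<close> \<open>q \<noteq> 0\<close>] by (simp add: right_diff_distrib ord_inf_def)
qed

lemma v_y_double: "2 * v (0, 1) = v (to_fract f, 0)"
  using v_mult[of "(0, 1)" "(0, 1)"] by simp

end


section \<open>Infinity and the branch points\<close>

text \<open>The norm of the quadratic extension of \<open>K(x)\<close> generated by
  \<open>y\<close>.\<close>

definition fnorm :: "'a::field poly \<Rightarrow> 'a poly fract \<times> 'a poly fract \<Rightarrow> 'a poly fract" where
  "fnorm f h = fst h ^ 2 - snd h ^ 2 * to_fract f"

lemma fnorm_mult: "fnorm f (s \<otimes>\<^bsub>function_field f\<^esub> t) = fnorm f s * fnorm f t"
  by (cases s; cases t) (simp add: fnorm_def power2_eq_square algebra_simps)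

text \<open>For \<open>u\<close> in \<open>K(x)\<close> the norm is \<open>u^2\<close>, so the
  ramification index 2 is built in. The value at zero is pinned as \<open>discrete_valuation\<close>
  requires.\<close>

definition ram_val :: "('a::field poly \<Rightarrow> int) \<Rightarrow> 'a poly \<Rightarrow> 'a poly fract \<times> 'a poly fract \<Rightarrow> int" where
  "ram_val d f h = (if h = (0, 0) then undefined else ratfun_order d (fnorm f h))"

locale ramified = poly_valuation d for d :: "'a::field poly \<Rightarrow> int" +
  fixes f :: "'a poly"
  assumes f_nonzero: "f \<noteq> 0" and odd_w_f: "odd (w (to_fract f))"
begin

abbreviation wf :: int where "wf \<equiv> w (to_fract f)"

lemma w_square: "u \<noteq> 0 \<Longrightarrow> w (u ^ 2) = 2 * w u"
  using w_power[of u 2] by simp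

lemma w_square_f: "t \<noteq> 0 \<Longrightarrow> w (t ^ 2 * to_fract f) = 2 * w t + wf"
  using w_mult[of "t ^ 2" "to_fract f"] f_nonzero w_square by simp

lemma parity: "2 * w u \<noteq> 2 * w t + wf"
  using odd_w_f by presburger

text \<open>The values of \<open>u^2\<close> and \<open>t^2 f\<close> have different parity, so the
  two terms of the norm cannot cancel and the smaller value wins.\<close>

lemma w_fnorm:
  assumes "u \<noteq> 0" "t \<noteq> 0"
  shows "fnorm f (u, t) \<noteq> 0" "w (fnorm f (u, t)) = min (2 * w u) (2 * w t + wf)"
proof -
  have nz: "u ^ 2 \<noteq> 0" "- (t ^ 2 * to_fract f) \<noteq> 0" using assms f_nonzero by auto
  have *: "w (u ^ 2) = 2 * w u" "w (- (t ^ 2 * to_fract f)) = 2 * w t + wf"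
    using assms w_square w_square_f by simp_all
  have "fnorm f (u, t) \<noteq> 0 \<and> w (fnorm f (u, t)) = min (2 * w u) (2 * w t + wf)"
  proof (cases "2 * w u < 2 * w t + wf")
    case True
    then show ?thesis using w_add_eq[of "u ^ 2" "- (t ^ 2 * to_fract f)"] nz * by (simp add: fnorm_def)
  next
    case False
    then have "2 * w t + wf < 2 * w u" using parity[of u t] by simp
    then show ?thesis using w_add_eq[of "- (t ^ 2 * to_fract f)" "u ^ 2"] nz * by (simp add: fnorm_def)
  qed
  then show "fnorm f (u, t) \<noteq> 0" "w (fnorm f (u, t)) = min (2 * w u) (2 * w t + wf)" by blast+
qed

text \<open>In other words, \<open>f\<close> is not a square in \<open>K(x)\<close>. Through the
  norm this yields the absence of zero divisors and the existence of inverses in the function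
  field.\<close>

lemma fnorm_nonzero: "h \<noteq> (0, 0) \<Longrightarrow> fnorm f h \<noteq> 0"
  using w_fnorm(1)[of "fst h" "snd h"] f_nonzero
  by (cases "fst h = 0"; cases "snd h = 0") (auto simp: fnorm_def prod_eq_iff)

lemma mult_nonzero: "s \<noteq> (0, 0) \<Longrightarrow> t \<noteq> (0, 0) \<Longrightarrow> s \<otimes>\<^bsub>function_field f\<^esub> t \<noteq> (0, 0)"
  using fnorm_mult[of f s t] fnorm_nonzero[of s] fnorm_nonzero[of t] by (auto simp: fnorm_def)

lemma ram_val_rat: "u \<noteq> 0 \<Longrightarrow> ram_val d f (u, 0) = 2 * w u"
  by (simp add: ram_val_def fnorm_def w_square)

lemma ram_val_y: "t \<noteq> 0 \<Longrightarrow> ram_val d f (0, t) = 2 * w t + wf"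
  by (simp add: ram_val_def fnorm_def w_square_f)

text \<open>Lower bounds can be tested on the two coordinates separately, which reduces the
  ultrametric inequality to that of \<open>w\<close>.\<close>

lemma ram_val_ge_iff:
  assumes "(u, t) \<noteq> (0, 0)"
  shows "n \<le> ram_val d f (u, t) \<longleftrightarrow> (u \<noteq> 0 \<longrightarrow> n \<le> 2 * w u) \<and> (t \<noteq> 0 \<longrightarrow> n \<le> 2 * w t + wf)"
proof (cases "u = 0 \<or> t = 0")
  case True
  then show ?thesis using assms ram_val_rat[of u] ram_val_y[of t] by auto
next
  case False
  then show ?thesis using w_fnorm[of u t] by (simp add: ram_val_def)
qed

lemma ram_val_ultrametric:
  assumes "(u, t) \<noteq> (0, 0)" "(u', t') \<noteq> (0, 0)" "(u + u', t + t') \<noteq> (0, 0)"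
  shows "min (ram_val d f (u, t)) (ram_val d f (u', t')) \<le> ram_val d f (u + u', t + t')"
proof -
  define n where "n = min (ram_val d f (u, t)) (ram_val d f (u', t'))"
  have "n \<le> ram_val d f (u, t)" "n \<le> ram_val d f (u', t')" by (auto simp: n_def)
  then have *: "u \<noteq> 0 \<Longrightarrow> n \<le> 2 * w u" "t \<noteq> 0 \<Longrightarrow> n \<le> 2 * w t + wf"
    "u' \<noteq> 0 \<Longrightarrow> n \<le> 2 * w u'" "t' \<noteq> 0 \<Longrightarrow> n \<le> 2 * w t' + wf"
    using ram_val_ge_iff assms by auto
  have "n \<le> 2 * w (u + u')" if "u + u' \<noteq> 0"
    using that * w_add[of u u'] by (cases "u = 0"; cases "u' = 0") auto
  moreover have "n \<le> 2 * w (t + t') + wf" if "t + t' \<noteq> 0"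
    using that * w_add[of t t'] by (cases "t = 0"; cases "t' = 0") auto
  ultimately show ?thesis using ram_val_ge_iff assms(3) by (simp add: n_def)
qed

lemma is_valuation_ram_val: "is_valuation f (ram_val d f)"
  unfolding is_valuation_iff
proof (intro conjI allI impI)
  show "ram_val d f \<in> extensional (- {(0, 0)})"
    by (auto simp: extensional_def ram_val_def)
  show "\<exists>h. h \<noteq> (0, 0) \<and> ram_val d f h = n" for n
  \<comment> \<open>Even values are attained by functions of \<open>x\<close> alone, odd ones by
    their multiples of \<open>y\<close>.\<close>
  proof (cases "even n")
    case True
    then obtain k where "n = 2 * k" by blast
    obtain u where "u \<noteq> 0" "w u = k" using w_surj by blast
    then show ?thesis using ram_val_rat[of u] \<open>n = 2 * k\<close> by (intro exI[of _ "(u, 0)"]) simp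
  next
    case False
    then have "even (n - wf)" using odd_w_f by simp
    then obtain k where "n - wf = 2 * k" by blast
    then have "n = 2 * k + wf" by simp
    obtain t where "t \<noteq> 0" "w t = k" using w_surj by blast
    then show ?thesis using ram_val_y[of t] \<open>n = 2 * k + wf\<close> by (intro exI[of _ "(0, t)"]) simp
  qed
  show "ram_val d f (to_fract [:c:], 0) = 0" if "c \<noteq> 0" for c
    using that ram_val_rat[of "to_fract [:c:]"] by (simp add: w_poly d_const)
  show "ram_val d f (s \<otimes>\<^bsub>function_field f\<^esub> t) = ram_val d f s + ram_val d f t"
    if "s \<noteq> (0, 0)" "t \<noteq> (0, 0)" for s t
    using that mult_nonzero[of s t] fnorm_nonzero by (simp add: ram_val_def fnorm_mult w_mult)
  show "min (ram_val d f s) (ram_val d f t) \<le> ram_val d f (s \<oplus>\<^bsub>function_field f\<^esub> t)"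
    if "s \<noteq> (0, 0)" "t \<noteq> (0, 0)" "s \<oplus>\<^bsub>function_field f\<^esub> t \<noteq> (0, 0)" for s t
    using that ram_val_ultrametric by (cases s; cases t) simp
qed

text \<open>
  Since \<open>2 v(y)\<close> is an odd multiple of \<open>m\<close>, the two summands of \<open>u + t y\<close> have different values.
\<close>
lemma ram_val_unique:
  assumes v: "curve_valuation f v" and m: "m > 0" "\<And>s. s \<noteq> 0 \<Longrightarrow> v (s, 0) = m * w s"
  shows "v = ram_val d f"
proof -
  interpret curve_valuation f v by fact
  have y: "2 * v (0, 1) = m * wf" using v_y_double m f_nonzero by simp
  \<comment> \<open>The product \<open>m * wf\<close> is twice the value of \<open>y\<close>, while
    \<open>wf\<close> is odd.\<close>
  then have "even m" using odd_w_f by (metis dvd_triv_left even_mult_iff)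
  then obtain k where k: "m = 2 * k" by blast
  have rat: "v (s, 0) = k * ram_val d f (s, 0)" if "s \<noteq> 0" for s
    using that m k ram_val_rat by simp
  have irr: "v (0, t) = k * ram_val d f (0, t)" if "t \<noteq> 0" for t
    using that v_mult[of "(t, 0)" "(0, 1)"] y m k ram_val_y[of t] by (simp add: algebra_simps)
  have k0: "k > 0" using k m by simp
  have eq: "v (u, t) = k * ram_val d f (u, t)" if "(u, t) \<noteq> (0, 0)" for u t
  proof (cases "u = 0 \<or> t = 0")
    case True
    then show ?thesis using that rat irr by auto
  next
    case False
    then have r: "ram_val d f (u, t) = min (2 * w u) (2 * w t + wf)"
      using w_fnorm[of u t] by (simp add: ram_val_def)
    have *: "v (u, 0) = k * (2 * w u)" "v (0, t) = k * (2 * w t + wf)"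
      using False rat irr ram_val_rat ram_val_y by auto
    show ?thesis
    proof (cases "2 * w u < 2 * w t + wf")
      case True
      then have "v (u, 0) < v (0, t)" unfolding * using k0 by simp
      then show ?thesis using v_add_eq(2)[of "(u, 0)" "(0, t)"] False True r * by simp
    next
      case F: False
      then have lt: "2 * w t + wf < 2 * w u" using parity[of u t] by simp
      then have "v (0, t) < v (u, 0)" unfolding * using k0 by simp
      then show ?thesis using v_add_eq(2)[of "(0, t)" "(u, 0)"] False lt r * by simp
    qed
  qed
  \<comment> \<open>Normalization: a positive multiple \<open>k\<close> of an integer-valued
    function takes the value 1 only if \<open>k = 1\<close>.\<close>
  obtain h where "h \<noteq> (0, 0)" "v h = 1" using v_surj by blast
  then have "k * ram_val d f h = 1" using eq by (cases h) simp
  then have "k = 1" using k0 zmult_eq_1_iff by auto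
  then have "v h = ram_val d f h" if "h \<noteq> (0, 0)" for h using eq that by (cases h) simp
  moreover have "v (0, 0) = ram_val d f (0, 0)"
    using v_ext by (simp add: ram_val_def extensional_def)
  ultimately show ?thesis by (intro ext) (metis)
qed

end

section \<open>The valuations centered at infinity and at the branch points\<close>

context odd_curve begin

lemma ramified_inf: "ramified ord_inf f"
  using odd_deg f_nz by unfold_locales (auto simp: w_inf_f)

lemma ramified_fin: "poly f a = 0 \<Longrightarrow> ramified (ord_fin a) f"
  using f_nz by unfold_locales (auto simp: w_fin_f)

lemma centered_Aff:
  "centered_at f v (Aff a b) \<longleftrightarrow> v (to_fract [:-a, 1:], 0) > 0 \<and> v (- to_fract [:b:], 1) > 0"
proof -
  have "to_fract [:0, 1:] - to_fract [:a:] = to_fract [:-a, 1:]"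
    by (subst to_fract_diff [symmetric]) simp
  then show ?thesis by (simp add: x_fn_def y_fn_def const_fn_def del: to_fract_diff)
qed

lemma centered_Infty: "centered_at f v Infty \<longleftrightarrow> v (to_fract [:0, 1:], 0) < 0"
  by (simp add: x_fn_def)

lemma ord_at_eqI:
  assumes "is_valuation f v" "centered_at f v P"
    and "\<And>v'. curve_valuation f v' \<Longrightarrow> centered_at f v' P \<Longrightarrow> v' = v"
  shows "ord_at f P = v"
  unfolding ord_at_def using assms by (blast intro: the_equality curve_valuation.intro)

lemma centered_ram_val_Infty: "centered_at f (ram_val ord_inf f) Infty"
proof -
  interpret ramified ord_inf f by (rule ramified_inf)
  have "ram_val ord_inf f (to_fract [:0, 1:], 0) = - 2"
    by (subst ram_val_rat) (simp_all add: inf.w_poly ord_inf_def)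
  then show ?thesis by (simp add: centered_Infty del: centered_at.simps)
qed

lemma centered_ram_val_branch:
  assumes "poly f a = 0"
  shows "centered_at f (ram_val (ord_fin a) f) (Aff a 0)"
proof -
  interpret ramified "ord_fin a" f using assms by (rule ramified_fin)
  have "ram_val (ord_fin a) f (to_fract [:-a, 1:], 0) = 2"
    by (subst ram_val_rat) (simp_all add: fin.w_poly ord_fin_def order_linear)
  moreover have "ram_val (ord_fin a) f (0, 1) = 1"
    using ram_val_y[of 1] w_fin_f[of a] assms by simp
  ultimately show ?thesis by (simp add: centered_Aff del: centered_at.simps)
qed

lemma ord_at_Infty: "ord_at f Infty = ram_val ord_inf f"
proof -
  interpret ramified ord_inf f by (rule ramified_inf)
  show ?thesis
  proof (rule ord_at_eqI)
    show "is_valuation f (ram_val ord_inf f)" by (rule is_valuation_ram_val)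
    show "centered_at f (ram_val ord_inf f) Infty" by (rule centered_ram_val_Infty)
    fix v assume v: "curve_valuation f v" "centered_at f v Infty"
    then have neg: "v (to_fract [:0, 1:], 0) < 0" by (simp only: centered_Infty)
    show "v = ram_val ord_inf f"
    proof (rule ram_val_unique[OF v(1)])
      show "0 < - v (to_fract [:0, 1:], 0)" using neg by simp
    qed (rule curve_valuation.v_rat_inf[OF v(1) neg])
  qed
qed

lemma ord_at_branch:
  assumes "poly f a = 0"
  shows "ord_at f (Aff a 0) = ram_val (ord_fin a) f"
proof -
  interpret ramified "ord_fin a" f using assms by (rule ramified_fin)
  show ?thesis
  proof (rule ord_at_eqI)
    show "is_valuation f (ram_val (ord_fin a) f)" by (rule is_valuation_ram_val)
    show "centered_at f (ram_val (ord_fin a) f) (Aff a 0)"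
      using assms by (rule centered_ram_val_branch)
    fix v assume v: "curve_valuation f v" "centered_at f v (Aff a 0)"
    then have pos: "v (to_fract [:-a, 1:], 0) > 0" by (simp only: centered_Aff)
    show "v = ram_val (ord_fin a) f"
    proof (rule ram_val_unique[OF v(1)])
      show "0 < v (to_fract [:-a, 1:], 0)" using pos by simp
    qed (rule curve_valuation.v_rat_fin[OF v(1) pos])
  qed
qed

end


section \<open>Points with nonzero ordinate\<close>

definition fscale :: "'a::field poly fract \<Rightarrow> 'a poly fract \<times> 'a poly fract \<Rightarrow> 'a poly fract \<times> 'a poly fract" where
  "fscale c h = (c * fst h, c * snd h)"

lemma fscale_mult:
  "fscale c s \<otimes>\<^bsub>function_field f\<^esub> t = fscale c (s \<otimes>\<^bsub>function_field f\<^esub> t)"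
  "s \<otimes>\<^bsub>function_field f\<^esub> fscale c t = fscale c (s \<otimes>\<^bsub>function_field f\<^esub> t)"
  by (cases s; cases t; simp add: fscale_def algebra_simps)+

lemma fscale_fscale: "fscale c (fscale d h) = fscale (c * d) h"
  by (simp add: fscale_def algebra_simps)

lemma function_field_assoc:
  "(r \<otimes>\<^bsub>function_field f\<^esub> s) \<otimes>\<^bsub>function_field f\<^esub> t = r \<otimes>\<^bsub>function_field f\<^esub> (s \<otimes>\<^bsub>function_field f\<^esub> t)"
  by (cases r; cases s; cases t) (simp add: algebra_simps)

lemma function_field_comm: "s \<otimes>\<^bsub>function_field f\<^esub> t = t \<otimes>\<^bsub>function_field f\<^esub> s"
  by (cases s; cases t) (simp add: algebra_simps)

lemma to_fract_power: "to_fract (p ^ n) = to_fract p ^ n"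
  by (induction n) auto

lemma strip_linear_factor:
  fixes p :: "'a::field poly"
  assumes "p \<noteq> 0"
  obtains m p' where "p = [:-a, 1:] ^ m * p'" "poly p' a \<noteq> 0"
  using order_decomp[OF assms, of a] poly_eq_0_iff_dvd by metis

lemma strip_linear_factors:
  fixes p q :: "'a::field poly"
  assumes "p \<noteq> 0 \<or> q \<noteq> 0"
  obtains m p' q' where "p = [:-a, 1:] ^ m * p'" "q = [:-a, 1:] ^ m * q'" "poly p' a \<noteq> 0 \<or> poly q' a \<noteq> 0"
proof -
  define l where "l = [:-a, 1:]"
  define S where "S = {m. l ^ m dvd p \<and> l ^ m dvd q}"
  \<comment> \<open>One of \<open>p\<close> and \<open>q\<close> may be zero; the other one then
    bounds the exponents.\<close>
  have "S \<subseteq> {..max (Polynomial.order a p) (Polynomial.order a q)}"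
    using assms by (auto simp: S_def l_def order_divides)
  then have fin: "finite S" using finite_subset by blast
  have "0 \<in> S" by (simp add: S_def)
  then have "Max S \<in> S" using fin by (intro Max_in) auto
  then obtain p' q' where *: "p = l ^ Max S * p'" "q = l ^ Max S * q'"
    unfolding S_def by (auto elim!: dvdE)
  have "poly p' a \<noteq> 0 \<or> poly q' a \<noteq> 0"
  proof (rule ccontr)
    assume "\<not> ?thesis"
    then have "l dvd p'" "l dvd q'" by (auto simp: l_def poly_eq_0_iff_dvd)
    then have "l ^ Suc (Max S) dvd p" "l ^ Suc (Max S) dvd q"
      using *  by (metis mult_dvd_mono dvd_refl power_Suc2)+
    then have "Suc (Max S) \<in> S" by (simp add: S_def)
    then show False using fin Max_ge by (metis not_less_eq_eq order_refl)
  qed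
  then show ?thesis using * that unfolding l_def by blast
qed

text \<open>A point whose fibre over the line also contains the distinct point
  \<open>(a, - b)\<close>; the place \<open>x = a\<close> splits and \<open>x - a\<close> is a
  uniformizer.\<close>

locale split_point = odd_curve f for f :: "'a::alg_closed_field poly" +
  fixes a b :: 'a
  assumes on_curve: "b ^ 2 = poly f a" and b_nz: "b \<noteq> 0"
begin

abbreviation tpi :: "'a poly fract" where "tpi \<equiv> to_fract [:-a, 1:]"

text \<open>
  The elements \<open>p + q y\<close> of the coordinate ring that do not vanish at \<open>(a, b)\<close>. Every nonzero
  function is a power of the uniformizer \<open>x - a\<close> times a quotient of two of them, and the exponent
  is its order at \<open>(a, b)\<close>.
\<close>
definition units :: "('a poly fract \<times> 'a poly fract) set" where
  "units = {(to_fract p, to_fract q) | p q. poly p a + poly q a * b \<noteq> 0}"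

text \<open>Cross-multiplied, so that no inverse of a unit has to be formed.\<close>

definition has_order :: "'a poly fract \<times> 'a poly fract \<Rightarrow> int \<Rightarrow> bool" where
  "has_order h n \<longleftrightarrow> (\<exists>s\<in>units. \<exists>r\<in>units. s \<otimes>\<^bsub>function_field f\<^esub> h = fscale (tpi powi n) r)"

lemma unitsI: "poly p a + poly q a * b \<noteq> 0 \<Longrightarrow> (to_fract p, to_fract q) \<in> units"
  by (auto simp: units_def)

lemma unitsI_rat: "poly p a \<noteq> 0 \<Longrightarrow> (to_fract p, 0) \<in> units"
  using unitsI[of p 0] by simp

lemma one_unit: "(1, 0) \<in> units"
  using unitsI_rat[of 1] by simp

lemma poly_pair_mult:
  "(to_fract p, to_fract q) \<otimes>\<^bsub>function_field f\<^esub> (to_fract p', to_fract q')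
     = (to_fract (p * p' + q * q' * f), to_fract (p * q' + q * p'))"
  by simp

text \<open>Evaluation at \<open>(a, b)\<close> respects products because
  \<open>b^2 = poly f a\<close> matches the relation \<open>y^2 = f\<close>. Hence
  \<open>units\<close> is closed under multiplication.\<close>

lemma eval_mult:
  "poly (p * p' + q * q' * f) a + poly (p * q' + q * p') a * b = (poly p a + poly q a * b) * (poly p' a + poly q' a * b)"
  using on_curve by (simp add: algebra_simps power2_eq_square flip: on_curve)

lemma units_mult: "s \<in> units \<Longrightarrow> r \<in> units \<Longrightarrow> s \<otimes>\<^bsub>function_field f\<^esub> r \<in> units"
proof -
  assume "s \<in> units" "r \<in> units"
  then obtain p q p' q' where *: "s = (to_fract p, to_fract q)" "poly p a + poly q a * b \<noteq> 0"
    "r = (to_fract p', to_fract q')" "poly p' a + poly q' a * b \<noteq> 0"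
    by (auto simp: units_def)
  then show ?thesis
    unfolding *(1,3) poly_pair_mult by (intro unitsI) (simp only: eval_mult mult_eq_0_iff, simp)
qed

lemma units_nz: "(0, 0) \<notin> units"
  by (auto simp: units_def)

lemma ff_mult_nz: "s \<noteq> (0, 0) \<Longrightarrow> t \<noteq> (0, 0) \<Longrightarrow> s \<otimes>\<^bsub>function_field f\<^esub> t \<noteq> (0, 0)"
  by (rule ramified.mult_nonzero[OF ramified_inf])

lemma tpi_powi_add: "tpi powi (m + n) = tpi powi m * tpi powi n"
  by (rule power_int_add) simp

text \<open>Coordinates with respect to \<open>1, y\<close> are unique, so a positive power of
  \<open>x - a\<close> divides both coordinates of the product, which therefore vanishes at
  \<open>(a, b)\<close>.\<close>

lemma not_unit_fscale:
  assumes "x \<in> units" "n > 0" "x' = fscale (tpi powi n) x"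
  shows "x' \<notin> units"
proof
  assume "x' \<in> units"
  then obtain p q p' q' where *: "x = (to_fract p, to_fract q)"
    "x' = (to_fract p', to_fract q')" "poly p' a + poly q' a * b \<noteq> 0"
    using assms by (auto simp: units_def)
  have "tpi powi n = to_fract ([:-a, 1:] ^ nat n)"
    using assms(2) by (simp add: power_int_def to_fract_power)
  then have "to_fract p' = to_fract ([:-a, 1:] ^ nat n * p)" "to_fract q' = to_fract ([:-a, 1:] ^ nat n * q)"
    using * assms by (simp_all add: fscale_def)
  then have "p' = [:-a, 1:] ^ nat n * p" "q' = [:-a, 1:] ^ nat n * q"
    by (simp_all only: to_fract_eq_iff)
  then show False using * assms(2) by (simp add: power_0_left)
qed

text \<open>Computing the product of \<open>s\<close>, \<open>s'\<close> and \<open>h\<close> in two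
  ways shows that, for different orders, a unit times a positive power of \<open>x - a\<close> would
  again be a unit.\<close>

lemma has_order_unique:
  assumes "has_order h n" "has_order h n'"
  shows "n = n'"
proof -
  have "\<not> n' < n" if "has_order h n" "has_order h n'" for n n'
  proof
    assume lt: "n' < n"
    obtain s r where sr: "s \<in> units" "r \<in> units" "s \<otimes>\<^bsub>function_field f\<^esub> h = fscale (tpi powi n) r"
      using \<open>has_order h n\<close> by (auto simp: has_order_def)
    obtain s' r' where sr': "s' \<in> units" "r' \<in> units" "s' \<otimes>\<^bsub>function_field f\<^esub> h = fscale (tpi powi n') r'"
      using \<open>has_order h n'\<close> by (auto simp: has_order_def)
    have "fscale (tpi powi n) (s' \<otimes>\<^bsub>function_field f\<^esub> r) = s' \<otimes>\<^bsub>function_field f\<^esub> (s \<otimes>\<^bsub>function_field f\<^esub> h)"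
      unfolding sr by (simp add: fscale_mult)
    also have "\<dots> = s \<otimes>\<^bsub>function_field f\<^esub> (s' \<otimes>\<^bsub>function_field f\<^esub> h)"
      by (metis function_field_assoc function_field_comm)
    also have "\<dots> = fscale (tpi powi n') (s \<otimes>\<^bsub>function_field f\<^esub> r')"
      unfolding sr' by (simp add: fscale_mult)
    finally have "fscale (tpi powi (- n')) (fscale (tpi powi n) (s' \<otimes>\<^bsub>function_field f\<^esub> r))
        = fscale (tpi powi (- n')) (fscale (tpi powi n') (s \<otimes>\<^bsub>function_field f\<^esub> r'))"
      by (rule arg_cong)
    then have "s \<otimes>\<^bsub>function_field f\<^esub> r' = fscale (tpi powi (n - n')) (s' \<otimes>\<^bsub>function_field f\<^esub> r)"
      unfolding fscale_fscale tpi_powi_add[symmetric] by (simp add: fscale_def)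
    then show False
      using not_unit_fscale[OF units_mult[OF sr'(1) sr(2)]] units_mult[OF sr(1) sr'(2)] lt by simp
  qed
  then show ?thesis using assms by (meson linorder_neqE)
qed

text \<open>
  After removing common factors of \<open>x - a\<close>, either \<open>p + q y\<close> or its conjugate does not vanish at
  \<open>(a, b)\<close>, because \<open>2 b \<noteq> 0\<close>; in the latter case multiply by the conjugate to pass to the norm.
\<close>
lemma has_order_poly:
  assumes "p \<noteq> 0 \<or> q \<noteq> 0"
  shows "\<exists>n\<ge>0. has_order (to_fract p, to_fract q) n"
proof -
  obtain m p' q' where *: "p = [:-a, 1:] ^ m * p'" "q = [:-a, 1:] ^ m * q'" "poly p' a \<noteq> 0 \<or> poly q' a \<noteq> 0"
    using strip_linear_factors[OF assms] by blast
  have h: "(to_fract p, to_fract q) = fscale (tpi powi int m) (to_fract p', to_fract q')"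
    unfolding * by (simp only: fscale_def to_fract_mult to_fract_power power_int_of_nat fst_conv snd_conv)
  show ?thesis
  proof (cases "poly p' a + poly q' a * b = 0")
    case False
    have "(1, 0) \<otimes>\<^bsub>function_field f\<^esub> (to_fract p, to_fract q) = fscale (tpi powi int m) (to_fract p', to_fract q')"
      unfolding h by (simp add: fscale_def)
    then have "has_order (to_fract p, to_fract q) (int m)"
      unfolding has_order_def using one_unit unitsI[OF False] by blast
    then show ?thesis by (intro exI[of _ "int m"]) simp
  next
    case True
    have "poly q' a \<noteq> 0" using True *(3) by auto
    \<comment> \<open>As \<open>p'(a) = - b q'(a)\<close>, the conjugate takes the value
      \<open>- 2 b q'(a)\<close> at \<open>(a, b)\<close>.\<close>
    have "poly p' a + poly (- q') a * b = - 2 * (poly q' a * b)"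
      using True by (simp add: eq_neg_iff_add_eq_0[symmetric])
    also have "\<dots> \<noteq> 0" using \<open>poly q' a \<noteq> 0\<close> two_nz b_nz by simp
    finally have c: "(to_fract p', to_fract (- q')) \<in> units" by (rule unitsI)
    define N where "N = p' ^ 2 - q' ^ 2 * f"
    have N: "to_fract N = fnorm f (to_fract p', to_fract q')"
      by (simp add: N_def fnorm_def to_fract_power)
    moreover have "(to_fract p', to_fract q') \<noteq> (0, 0)" using *(3) by auto
    ultimately have "N \<noteq> 0"
      using ramified.fnorm_nonzero[OF ramified_inf] by (metis to_fract_0)
    then obtain j N' where N': "N = [:-a, 1:] ^ j * N'" "poly N' a \<noteq> 0"
      using strip_linear_factor by blast
    have "(to_fract p', to_fract (- q')) \<otimes>\<^bsub>function_field f\<^esub> (to_fract p', to_fract q') = (to_fract N, 0)"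
      by (simp add: N_def power2_eq_square algebra_simps)
    also have "\<dots> = fscale (tpi powi int j) (to_fract N', 0)"
      unfolding N' by (simp only: fscale_def to_fract_mult to_fract_power power_int_of_nat fst_conv snd_conv mult_zero_right)
    finally have "(to_fract p', to_fract (- q')) \<otimes>\<^bsub>function_field f\<^esub> (to_fract p, to_fract q)
        = fscale (tpi powi (int m + int j)) (to_fract N', 0)"
      unfolding h fscale_mult tpi_powi_add by (simp only: fscale_fscale)
    then have "has_order (to_fract p, to_fract q) (int m + int j)"
      unfolding has_order_def using c unitsI_rat[OF N'(2)] by blast
    then show ?thesis by (intro exI[of _ "int m + int j"]) simp
  qed
qed

lemma has_order_poly_nonneg:
  assumes "has_order (to_fract p, to_fract q) n" "p \<noteq> 0 \<or> q \<noteq> 0"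
  shows "n \<ge> 0"
  using has_order_poly[OF assms(2)] has_order_unique[OF assms(1)] by blast

text \<open>Order 0 would make a unit multiple of \<open>p + q y\<close> a unit, but by
  \<open>eval_mult\<close> that multiple still vanishes at \<open>(a, b)\<close>.\<close>

lemma has_order_poly_pos:
  assumes "has_order (to_fract p, to_fract q) n" "p \<noteq> 0 \<or> q \<noteq> 0" "poly p a + poly q a * b = 0"
  shows "n > 0"
proof (rule ccontr)
  assume "\<not> n > 0"
  then have "n = 0" using has_order_poly_nonneg assms by force
  then obtain s r where *: "s \<in> units" "r \<in> units" "s \<otimes>\<^bsub>function_field f\<^esub> (to_fract p, to_fract q) = r"
    using assms by (auto simp: has_order_def fscale_def)
  then obtain p1 q1 p2 q2 where "s = (to_fract p1, to_fract q1)"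
    "r = (to_fract p2, to_fract q2)" "poly p2 a + poly q2 a * b \<noteq> 0"
    by (auto simp: units_def)
  moreover from this have "p2 = p1 * p + q1 * q * f" "q2 = p1 * q + q1 * p"
    using *(3) by (auto simp flip: to_fract_mult to_fract_add)
  ultimately show False using eval_mult[of p1 p q1 q] assms(3) by simp
qed

text \<open>The common denominator \<open>d * e\<close> moves \<open>h\<close> into the coordinate
  ring. Its power of \<open>x - a\<close> shifts the order by \<open>- k\<close>, and the remaining
  factor \<open>D'\<close> is a unit.\<close>

lemma has_order_ex:
  assumes "h \<noteq> (0, 0)"
  shows "\<exists>n. has_order h n"
proof -
  obtain p d where pd: "d \<noteq> 0" "fst h = to_fract p / to_fract d" by (metis fract_decomp)
  obtain q e where qe: "e \<noteq> 0" "snd h = to_fract q / to_fract e" by (metis fract_decomp)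
  have D: "fscale (to_fract (d * e)) h = (to_fract (p * e), to_fract (q * d))"
    using pd qe by (simp add: fscale_def)
  have "p * e \<noteq> 0 \<or> q * d \<noteq> 0" using assms pd qe by (auto simp: prod_eq_iff)
  then obtain n where "has_order (to_fract (p * e), to_fract (q * d)) n" using has_order_poly by blast
  then obtain s r where sr: "s \<in> units" "r \<in> units"
    "s \<otimes>\<^bsub>function_field f\<^esub> fscale (to_fract (d * e)) h = fscale (tpi powi n) r"
    unfolding has_order_def D by blast
  obtain k D' where D': "d * e = [:-a, 1:] ^ k * D'" "poly D' a \<noteq> 0"
    using strip_linear_factor[of "d * e" a] pd qe by auto
  have "to_fract D' = tpi powi (- int k) * to_fract (d * e)"
    unfolding D' by (simp only: to_fract_mult to_fract_power power_int_minus power_int_of_nat) simp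
  moreover have "((to_fract D', 0) \<otimes>\<^bsub>function_field f\<^esub> s) \<otimes>\<^bsub>function_field f\<^esub> h
     = fscale (to_fract D') (s \<otimes>\<^bsub>function_field f\<^esub> h)"
    by (cases s; cases h) (simp add: fscale_def algebra_simps)
  ultimately have "((to_fract D', 0) \<otimes>\<^bsub>function_field f\<^esub> s) \<otimes>\<^bsub>function_field f\<^esub> h
     = fscale (tpi powi (- int k)) (s \<otimes>\<^bsub>function_field f\<^esub> fscale (to_fract (d * e)) h)"
    by (simp only: fscale_mult fscale_fscale)
  also have "\<dots> = fscale (tpi powi (- int k + n)) r"
    unfolding sr tpi_powi_add by (simp only: fscale_fscale)
  finally have "has_order h (- int k + n)"
    unfolding has_order_def using sr units_mult[OF unitsI_rat[OF D'(2)] sr(1)] by blast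
  then show ?thesis by blast
qed

lemma has_order_mult:
  assumes "has_order h n" "has_order h' n'"
  shows "has_order (h \<otimes>\<^bsub>function_field f\<^esub> h') (n + n')"
proof -
  obtain s r where sr: "s \<in> units" "r \<in> units" "s \<otimes>\<^bsub>function_field f\<^esub> h = fscale (tpi powi n) r"
    using assms(1) by (auto simp: has_order_def)
  obtain s' r' where sr': "s' \<in> units" "r' \<in> units" "s' \<otimes>\<^bsub>function_field f\<^esub> h' = fscale (tpi powi n') r'"
    using assms(2) by (auto simp: has_order_def)
  have "(s \<otimes>\<^bsub>function_field f\<^esub> s') \<otimes>\<^bsub>function_field f\<^esub> (h \<otimes>\<^bsub>function_field f\<^esub> h')
      = (s \<otimes>\<^bsub>function_field f\<^esub> h) \<otimes>\<^bsub>function_field f\<^esub> (s' \<otimes>\<^bsub>function_field f\<^esub> h')"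
    by (metis function_field_assoc function_field_comm)
  also have "\<dots> = fscale (tpi powi (n + n')) (r \<otimes>\<^bsub>function_field f\<^esub> r')"
    unfolding sr sr' fscale_mult fscale_fscale tpi_powi_add by (simp add: mult.commute)
  finally show ?thesis unfolding has_order_def using sr sr' units_mult by blast
qed

text \<open>Multiplied by the units \<open>s\<close> and \<open>s'\<close>, the sum becomes the
  \<open>n\<close>-th power of \<open>x - a\<close> times \<open>B\<close>. Since
  \<open>n \<le> n'\<close>, \<open>B\<close> lies in the coordinate ring, where orders are
  nonnegative.\<close>

lemma has_order_add:
  assumes "has_order h n" "has_order h' n'" "n \<le> n'" "h \<oplus>\<^bsub>function_field f\<^esub> h' \<noteq> (0, 0)"
  shows "\<exists>m\<ge>n. has_order (h \<oplus>\<^bsub>function_field f\<^esub> h') m"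
proof -
  obtain s r where sr: "s \<in> units" "r \<in> units" "s \<otimes>\<^bsub>function_field f\<^esub> h = fscale (tpi powi n) r"
    using assms(1) by (auto simp: has_order_def)
  obtain s' r' where sr': "s' \<in> units" "r' \<in> units" "s' \<otimes>\<^bsub>function_field f\<^esub> h' = fscale (tpi powi n') r'"
    using assms(2) by (auto simp: has_order_def)
  define B where "B = (s' \<otimes>\<^bsub>function_field f\<^esub> r) \<oplus>\<^bsub>function_field f\<^esub>
     fscale (tpi powi (n' - n)) (s \<otimes>\<^bsub>function_field f\<^esub> r')"
  have n': "tpi powi n' = tpi powi n * tpi powi (n' - n)"
    unfolding tpi_powi_add[symmetric] by simp
  have "(s \<otimes>\<^bsub>function_field f\<^esub> s') \<otimes>\<^bsub>function_field f\<^esub> (h \<oplus>\<^bsub>function_field f\<^esub> h')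
      = (s' \<otimes>\<^bsub>function_field f\<^esub> (s \<otimes>\<^bsub>function_field f\<^esub> h)) \<oplus>\<^bsub>function_field f\<^esub>
        (s \<otimes>\<^bsub>function_field f\<^esub> (s' \<otimes>\<^bsub>function_field f\<^esub> h'))"
    by (cases s; cases s'; cases h; cases h') (simp add: algebra_simps)
  also have "\<dots> = fscale (tpi powi n) B"
    unfolding sr sr' fscale_mult n' B_def
    by (cases s; cases s'; cases r; cases r') (simp add: fscale_def algebra_simps)
  finally have eq: "(s \<otimes>\<^bsub>function_field f\<^esub> s') \<otimes>\<^bsub>function_field f\<^esub> (h \<oplus>\<^bsub>function_field f\<^esub> h') = fscale (tpi powi n) B" .
  have ss': "s \<otimes>\<^bsub>function_field f\<^esub> s' \<in> units" using sr sr' units_mult by blast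
  then have "s \<otimes>\<^bsub>function_field f\<^esub> s' \<noteq> (0, 0)" using units_nz by metis
  then have "fscale (tpi powi n) B \<noteq> (0, 0)"
    unfolding eq[symmetric] using assms(4) by (rule ff_mult_nz)
  then have Bnz: "B \<noteq> (0, 0)" by (auto simp: fscale_def)
  have "s' \<otimes>\<^bsub>function_field f\<^esub> r \<in> units" "s \<otimes>\<^bsub>function_field f\<^esub> r' \<in> units"
    using sr sr' units_mult by blast+
  then obtain p q p' q' where pq: "s' \<otimes>\<^bsub>function_field f\<^esub> r = (to_fract p, to_fract q)"
    "s \<otimes>\<^bsub>function_field f\<^esub> r' = (to_fract p', to_fract q')" by (auto simp: units_def)
  have "tpi powi (n' - n) = to_fract ([:-a, 1:] ^ nat (n' - n))"
    using assms(3) by (simp add: power_int_def to_fract_power)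
  then have B: "B = (to_fract (p + [:-a, 1:] ^ nat (n' - n) * p'), to_fract (q + [:-a, 1:] ^ nat (n' - n) * q'))"
    unfolding B_def pq fscale_def by simp
  then obtain m where m: "m \<ge> 0" "has_order B m"
    using has_order_poly Bnz by (metis to_fract_0)
  then obtain s'' r'' where sr'': "s'' \<in> units" "r'' \<in> units" "s'' \<otimes>\<^bsub>function_field f\<^esub> B = fscale (tpi powi m) r''"
    by (auto simp: has_order_def)
  have "(s'' \<otimes>\<^bsub>function_field f\<^esub> (s \<otimes>\<^bsub>function_field f\<^esub> s')) \<otimes>\<^bsub>function_field f\<^esub> (h \<oplus>\<^bsub>function_field f\<^esub> h')
     = fscale (tpi powi (n + m)) r''"
    unfolding function_field_assoc[of f s''] eq fscale_mult sr'' fscale_fscale tpi_powi_add ..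
  then have "has_order (h \<oplus>\<^bsub>function_field f\<^esub> h') (n + m)"
    unfolding has_order_def using sr'' units_mult[OF sr''(1) ss'] by blast
  then show ?thesis using m by (intro exI[of _ "n + m"]) simp
qed

section \<open>The valuation given by the order at \<open>(a, b)\<close>\<close>

definition split_val :: "'a poly fract \<times> 'a poly fract \<Rightarrow> int" where
  "split_val h = (if h = (0, 0) then undefined else (THE n. has_order h n))"

lemma split_val_eqI: "h \<noteq> (0, 0) \<Longrightarrow> has_order h n \<Longrightarrow> split_val h = n"
  unfolding split_val_def using has_order_unique by (simp add: the_equality)

lemma has_order_split_val: "h \<noteq> (0, 0) \<Longrightarrow> has_order h (split_val h)"
  using has_order_ex split_val_eqI by metis

lemma has_order_tpi: "has_order (tpi powi n, 0) n"
  unfolding has_order_def using one_unit by (intro bexI[of _ "(1, 0)"]) (simp_all add: fscale_def)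

lemma is_valuation_split_val: "is_valuation f split_val"
  unfolding is_valuation_iff
proof (intro conjI allI impI)
  show "split_val \<in> extensional (- {(0, 0)})"
    by (auto simp: extensional_def split_val_def)
  show "\<exists>h. h \<noteq> (0, 0) \<and> split_val h = n" for n
    using split_val_eqI[OF _ has_order_tpi] by (intro exI[of _ "(tpi powi n, 0)"]) simp
  show "split_val (to_fract [:c:], 0) = 0" if "c \<noteq> 0" for c
  proof (rule split_val_eqI)
    show "has_order (to_fract [:c:], 0) 0"
      unfolding has_order_def using one_unit unitsI_rat[of "[:c:]"] that
      by (intro bexI[of _ "(1, 0)"] bexI[of _ "(to_fract [:c:], 0)"]) (simp_all add: fscale_def)
  qed (use that in simp)
  show "split_val (s \<otimes>\<^bsub>function_field f\<^esub> t) = split_val s + split_val t"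
    if "s \<noteq> (0, 0)" "t \<noteq> (0, 0)" for s t
    using that ff_mult_nz has_order_mult has_order_split_val by (intro split_val_eqI) auto
  show "min (split_val s) (split_val t) \<le> split_val (s \<oplus>\<^bsub>function_field f\<^esub> t)"
    if "s \<noteq> (0, 0)" "t \<noteq> (0, 0)" "s \<oplus>\<^bsub>function_field f\<^esub> t \<noteq> (0, 0)" for s t
  proof -
    have *: "split_val s \<le> split_val (s \<oplus>\<^bsub>function_field f\<^esub> t)"
      if "s \<noteq> (0, 0)" "t \<noteq> (0, 0)" "s \<oplus>\<^bsub>function_field f\<^esub> t \<noteq> (0, 0)" "split_val s \<le> split_val t" for s t
      using has_order_add[OF has_order_split_val[OF that(1)] has_order_split_val[OF that(2)] that(4,3)]
        split_val_eqI[OF that(3)] by auto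
    have comm: "s \<oplus>\<^bsub>function_field f\<^esub> t = t \<oplus>\<^bsub>function_field f\<^esub> s"
      by (cases s; cases t) simp
    show ?thesis
    proof (cases "split_val s \<le> split_val t")
      case True
      then show ?thesis using *[of s t] that by simp
    next
      case False
      then show ?thesis using *[of t s] that comm by simp
    qed
  qed
qed

lemma centered_split_val: "centered_at f split_val (Aff a b)"
proof -
  have "split_val (tpi, 0) = 1"
    using split_val_eqI[OF _ has_order_tpi[of 1]] by simp
  moreover have "split_val (- to_fract [:b:], 1) > 0"
    using has_order_split_val[of "(- to_fract [:b:], 1)"] has_order_poly_pos[of "[:-b:]" 1]
    by (simp flip: to_fract_uminus)
  ultimately show ?thesis by (simp add: centered_Aff del: centered_at.simps)
qed

text \<open>A valuation centered at \<open>(a, b)\<close> vanishes on \<open>units\<close>, so it is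
  \<open>v(x - a)\<close> times the order; surjectivity forces \<open>v(x - a) = 1\<close>.\<close>

lemma split_val_unique:
  assumes "curve_valuation f v" "centered_at f v (Aff a b)"
  shows "v = split_val"
proof -
  interpret curve_valuation f v by fact
  have x: "v (tpi, 0) > 0" and y: "v (- to_fract [:b:], 1) > 0"
    using assms(2) by (simp_all only: centered_Aff)
  have unit: "v r = 0" if ru: "r \<in> units" for r
  proof -
    obtain p q where r: "r = (to_fract p, to_fract q)" and ev: "poly p a + poly q a * b \<noteq> 0"
      using ru by (auto simp: units_def)
    \<comment> \<open>Rewrite \<open>p + q y\<close> as \<open>(p + b q) + q (y - b)\<close>: the
      first summand has value 0 and the second one, if nonzero, positive value.\<close>
    have c: "poly (p + Polynomial.smult b q) a \<noteq> 0" using ev by (simp add: mult.commute)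
    then have "p + Polynomial.smult b q \<noteq> 0" by (metis poly_0)
    then have 1: "v (to_fract (p + Polynomial.smult b q), 0) = 0" "to_fract (p + Polynomial.smult b q) \<noteq> 0"
      using v_poly_unit[OF x c] by (simp_all only: to_fract_eq_0_iff not_False_eq_True)
    show ?thesis
    proof (cases "q = 0")
      case True
      then show ?thesis using 1 r by simp
    next
      case False
      then have "v (to_fract q, 0) \<ge> 0" using v_poly_nonneg[of a q] x by simp
      moreover have "v ((to_fract q, 0) \<otimes>\<^bsub>function_field f\<^esub> (- to_fract [:b:], 1)) = v (to_fract q, 0) + v (- to_fract [:b:], 1)"
        using False by (intro v_mult) auto
      ultimately have 2: "v ((to_fract q, 0) \<otimes>\<^bsub>function_field f\<^esub> (- to_fract [:b:], 1)) > 0"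
        using y by linarith
      have "to_fract (Polynomial.smult b q) = to_fract q * to_fract [:b:]"
        by (simp flip: to_fract_mult)
      then have "r = (to_fract (p + Polynomial.smult b q), 0) \<oplus>\<^bsub>function_field f\<^esub>
          ((to_fract q, 0) \<otimes>\<^bsub>function_field f\<^esub> (- to_fract [:b:], 1))"
        by (simp add: r)
      then show ?thesis
        using v_add_eq(2)[of "(to_fract (p + Polynomial.smult b q), 0)"
            "(to_fract q, 0) \<otimes>\<^bsub>function_field f\<^esub> (- to_fract [:b:], 1)"] 1 2 False
        by (simp del: to_fract_add)
    qed
  qed
  have powi: "v (tpi powi n, 0) = n * v (tpi, 0)" for n
  proof (cases "n \<ge> 0")
    case True
    then show ?thesis using v_power_rat[of tpi "nat n"] by (simp add: power_int_def)
  next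
    case False
    then show ?thesis using v_power_rat[of tpi "nat (-n)"] v_quot_rat[of 1 "tpi ^ nat (-n)"] v_one
      by (simp add: power_int_def field_simps)
  qed
  have eq: "v h = split_val h * v (tpi, 0)" if h: "h \<noteq> (0, 0)" for h
  proof -
    define n where "n = split_val h"
    have "has_order h n" unfolding n_def using h by (rule has_order_split_val)
    then obtain s r where sr: "s \<in> units" "r \<in> units" "s \<otimes>\<^bsub>function_field f\<^esub> h = fscale (tpi powi n) r"
      by (auto simp: has_order_def)
    have nz: "s \<noteq> (0, 0)" "r \<noteq> (0, 0)" using sr units_nz by auto
    have "fscale (tpi powi n) r = (tpi powi n, 0) \<otimes>\<^bsub>function_field f\<^esub> r"
      by (cases r) (simp add: fscale_def)
    then have "v s + v h = v (tpi powi n, 0) + v r"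
      using v_mult[OF nz(1) h] v_mult[of "(tpi powi n, 0)" r] nz sr(3) by simp
    then show ?thesis using unit[OF sr(1)] unit[OF sr(2)] powi[of n] by (simp add: n_def)
  qed
  obtain h where "h \<noteq> (0, 0)" "v h = 1" using v_surj by blast
  then have "split_val h * v (tpi, 0) = 1" using eq[of h] by simp
  then have "v (tpi, 0) = 1" using x zmult_eq_1_iff by auto
  then have "v h = split_val h" if "h \<noteq> (0, 0)" for h using eq[OF that] by simp
  moreover have "v (0, 0) = split_val (0, 0)"
    using v_ext by (simp add: split_val_def extensional_def)
  ultimately show ?thesis by (intro ext) metis
qed

lemma ord_at_split: "ord_at f (Aff a b) = split_val"
  using ord_at_eqI is_valuation_split_val centered_split_val split_val_unique by blast

end


section \<open>Orders of functions at the points of the curve\<close>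

lemma fconj_mult: "fconj (s \<otimes>\<^bsub>function_field f\<^esub> t) = fconj s \<otimes>\<^bsub>function_field f\<^esub> fconj t"
  by (cases s; cases t) (simp add: fconj_def)

lemma fconj_add: "fconj (s \<oplus>\<^bsub>function_field f\<^esub> t) = fconj s \<oplus>\<^bsub>function_field f\<^esub> fconj t"
  by (cases s; cases t) (simp add: fconj_def)

lemma fconj_fconj [simp]: "fconj (fconj h) = h"
  by (simp add: fconj_def)

lemma fconj_eq_0_iff [simp]: "fconj h = (0, 0) \<longleftrightarrow> h = (0, 0)"
  by (cases h) (simp add: fconj_def)

context odd_curve begin

lemma is_valuation_fconj:
  assumes "is_valuation f v"
  shows "is_valuation f (\<lambda>h. if h = (0, 0) then undefined else v (fconj h))" (is "is_valuation f ?v")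
  unfolding is_valuation_iff
proof (intro conjI allI impI)
  interpret curve_valuation f v using assms by unfold_locales
  show "?v \<in> extensional (- {(0, 0)})"
    by (auto simp: extensional_def)
  show "\<exists>h. h \<noteq> (0, 0) \<and> ?v h = n" for n
  proof -
    obtain h where "h \<noteq> (0, 0)" "v h = n" using v_surj by blast
    then show ?thesis by (intro exI[of _ "fconj h"]) simp
  qed
  show "?v (to_fract [:c:], 0) = 0" if "c \<noteq> 0" for c
    using v_const[OF that] that by (simp add: fconj_def)
  show "?v (s \<otimes>\<^bsub>function_field f\<^esub> t) = ?v s + ?v t" if "s \<noteq> (0, 0)" "t \<noteq> (0, 0)" for s t
    using v_mult[of "fconj s" "fconj t"] ramified.mult_nonzero[OF ramified_inf that] that
    by (simp add: fconj_mult)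
  show "min (?v s) (?v t) \<le> ?v (s \<oplus>\<^bsub>function_field f\<^esub> t)"
    if "s \<noteq> (0, 0)" "t \<noteq> (0, 0)" "s \<oplus>\<^bsub>function_field f\<^esub> t \<noteq> (0, 0)" for s t
  proof -
    have "fconj s \<oplus>\<^bsub>function_field f\<^esub> fconj t \<noteq> (0, 0)"
      using that(3) unfolding fconj_add[symmetric] by simp
    then show ?thesis using v_add[of "fconj s" "fconj t"] that by (simp add: fconj_add)
  qed
qed

lemma Aff_in_curve [simp]: "Aff a b \<in> curve f \<longleftrightarrow> b ^ 2 = poly f a"
  by (auto simp: curve_def)

lemma Infty_in_curve [simp]: "Infty \<in> curve f"
  by (auto simp: curve_def)

lemma ord_at_valuation:
  assumes "P \<in> curve f"
  shows "is_valuation f (ord_at f P) \<and> centered_at f (ord_at f P) P"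
proof (cases P)
  case Infty
  show ?thesis
    unfolding Infty ord_at_Infty
    using ramified.is_valuation_ram_val[OF ramified_inf] centered_ram_val_Infty by blast
next
  case (Aff a b)
  show ?thesis
  proof (cases "b = 0")
    case True
    then have root: "poly f a = 0" using assms Aff by simp
    show ?thesis
      unfolding Aff True ord_at_branch[OF root]
      using ramified.is_valuation_ram_val[OF ramified_fin[OF root]] centered_ram_val_branch[OF root] by blast
  next
    case False
    then interpret split_point f a b using assms Aff by unfold_locales auto
    show ?thesis unfolding Aff ord_at_split using is_valuation_split_val centered_split_val by blast
  qed
qed

lemma ord_at_curve_valuation: "P \<in> curve f \<Longrightarrow> curve_valuation f (ord_at f P)"
  using ord_at_valuation curve_valuation.intro by blast

text \<open>The factor is the ramification index of the point over the
  \<open>x\<close>-line.\<close>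

lemma ord_at_rat:
  assumes "Aff a b \<in> curve f" "s \<noteq> 0"
  shows "ord_at f (Aff a b) (s, 0) = (if b = 0 then 2 else 1) * w_fin a s"
proof (cases "b = 0")
  case True
  then have root: "poly f a = 0" using assms by simp
  show ?thesis
    unfolding True ord_at_branch[OF root] using ramified.ram_val_rat[OF ramified_fin[OF root]] assms by simp
next
  case False
  then interpret split_point f a b using assms by unfold_locales auto
  interpret curve_valuation f split_val using is_valuation_split_val by unfold_locales
  have "split_val (tpi, 0) = 1"
    using split_val_eqI[OF _ has_order_tpi[of 1]] by simp
  then show ?thesis using v_rat_fin[of a s] assms False by (simp add: ord_at_split)
qed

text \<open>At a branch point the norm is invariant under conjugation. Elsewhere the valuation at
  \<open>(a, b)\<close>, transported along the involution, is centered at \<open>(a, - b)\<close>,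
  and uniqueness identifies it.\<close>

lemma ord_at_fconj:
  assumes "Aff a b \<in> curve f" "h \<noteq> (0, 0)"
  shows "ord_at f (Aff a b) (fconj h) = ord_at f (Aff a (- b)) h"
proof (cases "b = 0")
  case True
  then have root: "poly f a = 0" using assms by simp
  have "fnorm f (fconj h) = fnorm f h" by (simp add: fnorm_def fconj_def)
  then show ?thesis using True by (simp add: ord_at_branch[OF root] ram_val_def assms)
next
  case False
  interpret P: split_point f a b using assms False by unfold_locales auto
  interpret Q: split_point f a "- b" using assms False by unfold_locales auto
  define v where "v = (\<lambda>h. if h = (0, 0) then undefined else P.split_val (fconj h))"
  have val: "is_valuation f v" unfolding v_def by (rule is_valuation_fconj[OF P.is_valuation_split_val])
  interpret p: curve_valuation f P.split_val using P.is_valuation_split_val by unfold_locales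
  have "P.split_val (- to_fract [:-b:], - 1) = P.split_val (- to_fract [:b:], 1)"
    using p.v_uminus[of "- to_fract [:b:]" 1] by (simp flip: to_fract_uminus)
  moreover have "P.split_val (to_fract [:-a, 1:], 0) > 0" "P.split_val (- to_fract [:b:], 1) > 0"
    using P.centered_split_val by (simp_all only: centered_Aff)
  ultimately have "centered_at f v (Aff a (- b))"
    unfolding centered_Aff v_def by (simp add: fconj_def)
  then have "v = Q.split_val"
    using Q.split_val_unique val curve_valuation.intro by blast
  from fun_cong[OF this, of h] show ?thesis
    using assms(2) by (simp add: P.ord_at_split Q.ord_at_split v_def)
qed

section \<open>Functions determined by their zeros and poles\<close>

lemma curve_point_above: "\<exists>b. Aff a b \<in> curve f"
  using nth_root_exists[of 2 "poly f a"] by auto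

text \<open>
  The pole order of \<open>u + t y\<close> at infinity is at least \<open>degree f\<close> unless \<open>t = 0\<close>.
\<close>
lemma regular_imp_poly:
  assumes h: "h \<noteq> (0, 0)"
    and reg: "\<And>a b. Aff a b \<in> curve f \<Longrightarrow> ord_at f (Aff a b) h \<ge> 0"
    and inf: "ord_at f Infty h > - int (degree f)"
  obtains p where "p \<noteq> 0" "h = (to_fract p, 0)"
proof -
  obtain u t where ut: "h = (u, t)" by (cases h)
  \<comment> \<open>The trace \<open>h + fconj h\<close> equals \<open>2 u\<close>. Since
    conjugation permutes the affine points, \<open>u\<close> is regular at all of them.\<close>
  define two where "two = to_fract [:2::'a:]"
  have two: "two \<noteq> 0" by (simp add: two_def two_nz)
  have u_reg: "w_fin a u \<ge> 0" and uP: "\<And>b. Aff a b \<in> curve f \<Longrightarrow> ord_at f (Aff a b) (u, 0) \<ge> 0"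
    if "u \<noteq> 0" for a
  proof -
    have *: "ord_at f (Aff a b) (u, 0) \<ge> 0" if P: "Aff a b \<in> curve f" for b
    proof -
      interpret curve_valuation f "ord_at f (Aff a b)" using P by (rule ord_at_curve_valuation)
      have "Aff a (- b) \<in> curve f" using P by simp
      then have "ord_at f (Aff a b) (fconj h) \<ge> 0" using reg ord_at_fconj[OF P h] by simp
      moreover have sum: "h \<oplus>\<^bsub>function_field f\<^esub> fconj h = (two * u, 0)"
      proof -
        have "two = 1 + 1" unfolding two_def by (simp flip: to_fract_1 to_fract_add add: one_pCons)
        then show ?thesis by (simp add: ut fconj_def algebra_simps)
      qed
      ultimately have "ord_at f (Aff a b) (two * u, 0) \<ge> 0"
        using v_add[of h "fconj h"] h reg[OF P] two \<open>u \<noteq> 0\<close> unfolding sum by simp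
      then show ?thesis using v_mult_rat[OF two \<open>u \<noteq> 0\<close>] v_const[OF two_nz] by (simp add: two_def)
    qed
    then show "\<And>b. Aff a b \<in> curve f \<Longrightarrow> ord_at f (Aff a b) (u, 0) \<ge> 0" .
    obtain b where P: "Aff a b \<in> curve f" using curve_point_above by blast
    show "w_fin a u \<ge> 0" using *[OF P] ord_at_rat[OF P \<open>u \<noteq> 0\<close>] by (simp split: if_splits)
  qed
  have t_reg: "w_fin a t \<ge> 0" if "t \<noteq> 0" for a
  proof -
    obtain b where P: "Aff a b \<in> curve f" using curve_point_above by blast
    interpret curve_valuation f "ord_at f (Aff a b)" using P by (rule ord_at_curve_valuation)
    have "ord_at f (Aff a b) (0, t) \<ge> 0"
    proof (cases "u = 0")
      case True
      then show ?thesis using reg[OF P] ut by simp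
    next
      case False
      have "min (ord_at f (Aff a b) h) (ord_at f (Aff a b) (- u, - 0))
          \<le> ord_at f (Aff a b) (h \<oplus>\<^bsub>function_field f\<^esub> (- u, - 0))"
        using h False that by (intro v_add) (auto simp: ut)
      then show ?thesis using reg[OF P] uP[OF False P] unfolding v_uminus by (simp add: ut)
    qed
    \<comment> \<open>The square of \<open>t y\<close> is \<open>t^2 f\<close>. As \<open>f\<close>
      has order at most 1 at \<open>a\<close>, a nonnegative order of \<open>t^2 f\<close> forces
      \<open>w_fin a t\<close> to be nonnegative.\<close>
    moreover have "2 * ord_at f (Aff a b) (0, t) = ord_at f (Aff a b) (t * t * to_fract f, 0)"
      using v_mult[of "(0, t)" "(0, t)"] that by simp
    moreover have "w_fin a (t * t * to_fract f) = 2 * w_fin a t + w_fin a (to_fract f)"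
      using that f_nz by (simp add: fin.w_mult)
    ultimately have "2 * w_fin a t + w_fin a (to_fract f) \<ge> 0"
      using ord_at_rat[OF P, of "t * t * to_fract f"] that f_nz by (auto split: if_splits)
    then show ?thesis using w_fin_f[of a] by (auto split: if_splits)
  qed
  have "t = 0"
  proof (rule ccontr)
    assume "t \<noteq> 0"
    then obtain q where q: "t = to_fract q" using poly_if_w_fin_nonneg t_reg by blast
    then have "w_inf t \<le> 0" using \<open>t \<noteq> 0\<close> by (simp add: inf.w_poly ord_inf_def)
    \<comment> \<open>A nonzero polynomial \<open>t\<close> would give \<open>h\<close> a pole of
      order at least \<open>degree f\<close>, against \<open>inf\<close>.\<close>
    moreover have "ord_at f Infty h \<le> 2 * w_inf t + w_inf (to_fract f)"
      using ramified.ram_val_ge_iff[OF ramified_inf, of u t "ord_at f Infty h"] h \<open>t \<noteq> 0\<close>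
      by (simp add: ord_at_Infty ut)
    ultimately show False using inf w_inf_f by simp
  qed
  then have "u \<noteq> 0" using h ut by simp
  then obtain p where "u = to_fract p" using poly_if_w_fin_nonneg u_reg by blast
  then show ?thesis using \<open>u \<noteq> 0\<close> \<open>t = 0\<close> ut that by auto
qed

lemma ord_at_poly:
  assumes "Aff a b \<in> curve f" "p \<noteq> 0"
  shows "ord_at f (Aff a b) (to_fract p, 0) = (if b = 0 then 2 else 1) * int (Polynomial.order a p)"
  using ord_at_rat[OF assms(1), of "to_fract p"] assms(2) by (simp add: fin.w_poly ord_fin_def)

lemma ord_at_Infty_poly: "p \<noteq> 0 \<Longrightarrow> ord_at f Infty (to_fract p, 0) = - 2 * int (degree p)"
  using ramified.ram_val_rat[OF ramified_inf, of "to_fract p"] by (simp add: ord_at_Infty inf.w_poly ord_inf_def)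

lemma no_function_halving_point:
  assumes P: "Aff a b \<in> curve f" and h: "h \<noteq> (0, 0)"
    and ord: "\<And>c d. Aff c d \<in> curve f \<Longrightarrow>
        ord_at f (Aff c d) h = 2 * int (m (Aff c d)) - (if Aff c d = Aff a b then 1 else 0)"
    and inf: "ord_at f Infty h > 2 - int (degree f)"
  shows False
proof -
  define l where "l = [:-a, 1:]"
  have l: "(to_fract l, 0) \<noteq> (0, 0)" by (simp add: l_def)
  \<comment> \<open>Multiplying by \<open>x - a\<close> cancels the only possible affine pole, a
    simple one at \<open>(a, b)\<close>.\<close>
  define h' where "h' = h \<otimes>\<^bsub>function_field f\<^esub> (to_fract l, 0)"
  have h': "ord_at f Q h' = ord_at f Q h + ord_at f Q (to_fract l, 0)" if "Q \<in> curve f" for Q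
    unfolding h'_def using curve_valuation.v_mult[OF ord_at_curve_valuation[OF that] h l] .
  have ord_l: "Polynomial.order c l = (if c = a then 1 else 0)" for c
    by (auto simp: l_def order_linear intro: order_0I)
  have ord': "ord_at f (Aff c d) h' = 2 * int (m (Aff c d)) - (if Aff c d = Aff a b then 1 else 0)
     + (if c = a then if d = 0 then 2 else 1 else 0)" if "Aff c d \<in> curve f" for c d
    using h'[OF that] ord[OF that] ord_at_poly[OF that, of l] l ord_l[of c] by auto
  obtain p where p: "p \<noteq> 0" "h' = (to_fract p, 0)"
  proof (rule regular_imp_poly[of h'])
    show "h' \<noteq> (0, 0)" unfolding h'_def by (rule ramified.mult_nonzero[OF ramified_inf h l])
    show "ord_at f (Aff c d) h' \<ge> 0" if "Aff c d \<in> curve f" for c d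
      using ord'[OF that] by auto
    \<comment> \<open>The double pole of \<open>x - a\<close> at infinity accounts for the 2 in the
      hypothesis \<open>inf\<close>.\<close>
    show "ord_at f Infty h' > - int (degree f)"
      using h'[of Infty] inf ord_at_Infty_poly[of l] by (simp add: l_def)
  qed
  have P': "Aff a (- b) \<in> curve f" using P by simp
  show False
  proof (cases "b = 0")
    case True
    \<comment> \<open>At a branch point polynomials in \<open>x\<close> have even order, whereas
      \<open>2 m - 1 + 2\<close> is odd.\<close>
    then have "2 * int (Polynomial.order a p) = 2 * int (m (Aff a b)) + 1"
      using ord'[OF P] ord_at_poly[OF P p(1)] p(2) by simp
    then show False by presburger
  next
    case False
    have "b \<noteq> - b" using False two_nz by (simp add: eq_neg_iff_add_eq_0 flip: mult_2)
    \<comment> \<open>At \<open>(a, - b)\<close> the factor \<open>x - a\<close> adds 1 to an even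
      order; at \<open>(a, b)\<close> it cancels the \<open>- 1\<close>. A polynomial in
      \<open>x\<close> cannot tell the two points apart.\<close>
    then have "int (Polynomial.order a p) = 2 * int (m (Aff a (- b))) + 1"
      using ord'[OF P'] ord_at_poly[OF P' p(1)] p(2) False by auto
    moreover have "int (Polynomial.order a p) = 2 * int (m (Aff a b))"
      using ord'[OF P] ord_at_poly[OF P p(1)] p(2) False by simp
    ultimately show False by presburger
  qed
qed

text \<open>The pole bound makes \<open>h\<close> a polynomial in \<open>x\<close>. For nonzero
  \<open>b\<close> its orders at \<open>(a, b)\<close> and \<open>(a, - b)\<close> would agree, but
  they are prescribed as 2 and 0.\<close>

lemma two_torsion_point_is_branch:
  assumes P: "Aff a b \<in> curve f" and h: "h \<noteq> (0, 0)"
    and ord: "\<And>c d. Aff c d \<in> curve f \<Longrightarrow> ord_at f (Aff c d) h = (if Aff c d = Aff a b then 2 else 0)"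
    and inf: "ord_at f Infty h > - int (degree f)"
  shows "b = 0"
proof (rule ccontr)
  assume b: "b \<noteq> 0"
  obtain p where p: "p \<noteq> 0" "h = (to_fract p, 0)"
  proof (rule regular_imp_poly[OF h _ inf])
    show "ord_at f (Aff c d) h \<ge> 0" if "Aff c d \<in> curve f" for c d
      using ord[OF that] by simp
  qed
  have P': "Aff a (- b) \<in> curve f" using P by simp
  have "b \<noteq> - b" using b two_nz by (simp add: eq_neg_iff_add_eq_0 flip: mult_2)
  then show False
    using ord[OF P] ord[OF P'] ord_at_poly[OF P p(1)] ord_at_poly[OF P' p(1)] p(2) b by auto
qed

text \<open>This divisor is twice the branch point minus twice infinity, which makes the class of
  the branch point 2-torsion.\<close>

lemma ord_at_linear:
  assumes "poly f a = 0" "P \<in> curve f"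
  shows "ord_at f P (to_fract [:-a, 1:], 0) = (if P = Aff a 0 then 2 else if P = Infty then - 2 else 0)"
proof (cases P)
  case Infty
  then show ?thesis using ord_at_Infty_poly[of "[:-a, 1:]"] by simp
next
  case (Aff c d)
  then show ?thesis using ord_at_poly[of c d "[:-a, 1:]"] assms
    by (auto simp: order_linear intro!: order_0I)
qed

end


section \<open>The jacobian\<close>

lemma divisor_degree_superset:
  assumes "finite A" "Poly_Mapping.keys D \<subseteq> A"
  shows "divisor_degree D = (\<Sum>P\<in>A. Poly_Mapping.lookup D P)"
  unfolding divisor_degree_def using assms
  by (intro sum.mono_neutral_left) (auto simp: in_keys_iff)

lemma divisor_degree_add: "divisor_degree (D + E) = divisor_degree D + divisor_degree E"
proof -
  define A where "A = Poly_Mapping.keys D \<union> Poly_Mapping.keys E"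
  have "finite A" "Poly_Mapping.keys D \<subseteq> A" "Poly_Mapping.keys E \<subseteq> A" "Poly_Mapping.keys (D + E) \<subseteq> A"
    using keys_add[of D E] by (auto simp: A_def)
  then show ?thesis
    by (simp add: divisor_degree_superset lookup_add sum.distrib)
qed

lemma divisor_degree_0 [simp]: "divisor_degree 0 = 0"
  by (simp add: divisor_degree_def)

lemma divisor_degree_uminus: "divisor_degree (- D) = - divisor_degree D"
  using divisor_degree_add[of D "- D"] by simp

lemma divisor_degree_frag_of: "divisor_degree (frag_of P) = 1"
  by (simp add: divisor_degree_def keys_frag_of)

lemma divisor_degree_point_minus: "divisor_degree (frag_of P - frag_of Q) = 0"
  using divisor_degree_add[of "frag_of P" "- frag_of Q"]
  by (simp add: divisor_degree_uminus divisor_degree_frag_of)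

context odd_curve begin

lemma principal_iff:
  "D \<in> principal_divisors f \<longleftrightarrow> Poly_Mapping.keys D \<subseteq> curve f \<and>
     (\<exists>h. h \<noteq> (0, 0) \<and> (\<forall>P\<in>curve f. Poly_Mapping.lookup D P = ord_at f P h))"
  by (auto simp: principal_divisors_def Bex_def)

text \<open>The inverse is the conjugate divided by the norm.\<close>

lemma function_field_inverse:
  assumes "h \<noteq> (0, 0)"
  obtains k where "k \<noteq> (0, 0)" "h \<otimes>\<^bsub>function_field f\<^esub> k = (1, 0)"
proof -
  have N: "fnorm f h \<noteq> 0" by (rule ramified.fnorm_nonzero[OF ramified_inf assms])
  have "h \<otimes>\<^bsub>function_field f\<^esub> fconj h = (fnorm f h, 0)"
    by (cases h) (simp add: fconj_def fnorm_def power2_eq_square)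
  then have *: "h \<otimes>\<^bsub>function_field f\<^esub> fscale (inverse (fnorm f h)) (fconj h) = (1, 0)"
    unfolding fscale_mult using N by (simp add: fscale_def)
  moreover have "fscale (inverse (fnorm f h)) (fconj h) \<noteq> (0, 0)"
    using * by (cases h) auto
  ultimately show ?thesis using that by blast
qed

lemma principal_subgroup: "subgroup (principal_divisors f) (divisor_group f)"
proof (rule group.subgroupI)
  show "group (divisor_group f)" by simp
  show "principal_divisors f \<subseteq> carrier (divisor_group f)"
    by (auto simp: principal_divisors_def)
  have "\<forall>P\<in>curve f. Poly_Mapping.lookup 0 P = ord_at f P (1, 0)"
    using curve_valuation.v_one[OF ord_at_curve_valuation] by simp
  then have "0 \<in> principal_divisors f"
    unfolding principal_iff by (intro conjI exI[of _ "(1, 0)"]) simp_all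
  then show "principal_divisors f \<noteq> {}" by blast
next
  fix D assume D: "D \<in> principal_divisors f"
  then obtain h where h: "h \<noteq> (0, 0)" "\<forall>P\<in>curve f. Poly_Mapping.lookup D P = ord_at f P h"
    and keys: "Poly_Mapping.keys D \<subseteq> curve f" unfolding principal_iff by blast
  obtain k where k: "k \<noteq> (0, 0)" "h \<otimes>\<^bsub>function_field f\<^esub> k = (1, 0)"
    using function_field_inverse[OF h(1)] .
  have "ord_at f P k = - ord_at f P h" if "P \<in> curve f" for P
    using curve_valuation.v_mult[OF ord_at_curve_valuation[OF that] h(1) k(1)]
      curve_valuation.v_one[OF ord_at_curve_valuation[OF that]] k(2) by simp
  then have "- D \<in> principal_divisors f"
    unfolding principal_iff using h keys k(1) by (intro conjI exI[of _ k]) auto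
  then show "inv\<^bsub>divisor_group f\<^esub> D \<in> principal_divisors f" using keys by simp
next
  fix D E assume "D \<in> principal_divisors f" "E \<in> principal_divisors f"
  then obtain h k where h: "h \<noteq> (0, 0)" "\<forall>P\<in>curve f. Poly_Mapping.lookup D P = ord_at f P h"
    and k: "k \<noteq> (0, 0)" "\<forall>P\<in>curve f. Poly_Mapping.lookup E P = ord_at f P k"
    and keys: "Poly_Mapping.keys D \<subseteq> curve f" "Poly_Mapping.keys E \<subseteq> curve f"
    unfolding principal_iff by blast
  have "ord_at f P (h \<otimes>\<^bsub>function_field f\<^esub> k) = ord_at f P h + ord_at f P k" if "P \<in> curve f" for P
    using curve_valuation.v_mult[OF ord_at_curve_valuation[OF that] h(1) k(1)] .
  moreover have "h \<otimes>\<^bsub>function_field f\<^esub> k \<noteq> (0, 0)"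
    by (rule ramified.mult_nonzero[OF ramified_inf h(1) k(1)])
  moreover have "Poly_Mapping.keys (D + E) \<subseteq> curve f" using keys keys_add[of D E] by blast
  ultimately have "D + E \<in> principal_divisors f"
    unfolding principal_iff using h(2) k(2) by (intro conjI exI[of _ "h \<otimes>\<^bsub>function_field f\<^esub> k"]) (auto simp: lookup_add)
  then show "D \<otimes>\<^bsub>divisor_group f\<^esub> E \<in> principal_divisors f" by simp
qed

lemma principal_normal: "principal_divisors f \<lhd> divisor_group f"
  by (rule comm_group.subgroup_imp_normal[OF abelian_free_Abelian_group principal_subgroup])

lemma divisor_class_hom:
  "group_hom (divisor_group f) (divisor_group f Mod principal_divisors f) (divisor_class f)"
  using normal.r_coset_hom_Mod[OF principal_normal] normal.factorgroup_is_group[OF principal_normal]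
  by (auto simp: group_hom_def group_hom_axioms_def divisor_class_def[abs_def])

lemma degree_0_subgroup: "subgroup {D \<in> carrier (divisor_group f). divisor_degree D = 0} (divisor_group f)"
proof (rule group.subgroupI)
  have "0 \<in> {D \<in> carrier (divisor_group f). divisor_degree D = 0}" by simp
  then show "{D \<in> carrier (divisor_group f). divisor_degree D = 0} \<noteq> {}" by blast
qed (auto simp: divisor_degree_uminus divisor_degree_add dest: subsetD[OF keys_add])

lemma jacobian_subgroup:
  "subgroup (divisor_class f ` {D \<in> carrier (divisor_group f). divisor_degree D = 0})
     (divisor_group f Mod principal_divisors f)"
  using group_hom.subgroup_img_is_subgroup[OF divisor_class_hom degree_0_subgroup] .

lemma jacobian_group: "comm_group (jacobian f)"
proof (rule group.group_comm_groupI)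
  interpret Q: comm_group "divisor_group f Mod principal_divisors f"
    by (rule comm_group.abelian_FactGroup[OF abelian_free_Abelian_group principal_subgroup])
  show "group (jacobian f)"
    unfolding jacobian_def by (rule Q.subgroup_imp_group[OF jacobian_subgroup])
  show "x \<otimes>\<^bsub>jacobian f\<^esub> y = y \<otimes>\<^bsub>jacobian f\<^esub> x" if "x \<in> carrier (jacobian f)" "y \<in> carrier (jacobian f)" for x y
    using that subgroup.subset[OF jacobian_subgroup] Q.m_comm
    by (simp add: jacobian_def subset_iff del: mult_FactGroup)
qed

lemma carrier_jacobian:
  "carrier (jacobian f) = divisor_class f ` {D. Poly_Mapping.keys D \<subseteq> curve f \<and> divisor_degree D = 0}"
  by (simp add: jacobian_def)

lemma jacobian_mult:
  assumes "Poly_Mapping.keys D \<subseteq> curve f" "Poly_Mapping.keys E \<subseteq> curve f"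
  shows "divisor_class f D \<otimes>\<^bsub>jacobian f\<^esub> divisor_class f E = divisor_class f (D + E)"
  using group_hom.hom_mult[OF divisor_class_hom, of D E] assms by (simp add: jacobian_def)

lemma jacobian_one: "\<one>\<^bsub>jacobian f\<^esub> = divisor_class f 0"
  using group_hom.hom_one[OF divisor_class_hom] by (simp add: jacobian_def)

lemma divisor_class_eq_iff:
  assumes "Poly_Mapping.keys D \<subseteq> curve f" "Poly_Mapping.keys E \<subseteq> curve f"
  shows "divisor_class f D = divisor_class f E \<longleftrightarrow> D - E \<in> principal_divisors f"
proof -
  interpret group "divisor_group f" by simp
  have iff: "D \<in> divisor_class f E \<longleftrightarrow> D - E \<in> principal_divisors f"
    by (auto simp: divisor_class_def r_coset_def) (metis diff_add_cancel)
  have "divisor_class f D = divisor_class f E \<Longrightarrow> D \<in> divisor_class f E"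
    using repr_independenceD[OF principal_subgroup, of D E] assms by (simp add: divisor_class_def)
  moreover have "D \<in> divisor_class f E \<Longrightarrow> divisor_class f D = divisor_class f E"
    using repr_independence[OF _ _ principal_subgroup, of D E] assms by (simp add: divisor_class_def)
  ultimately show ?thesis using iff by blast
qed

section \<open>Points of the curve and their sums in the jacobian\<close>

lemma keys_point_minus: "P \<in> curve f \<Longrightarrow> Poly_Mapping.keys (frag_of P - frag_of Infty) \<subseteq> curve f"
  using keys_diff[of "frag_of P" "frag_of Infty"] by (auto simp: keys_frag_of)

lemma jac_point_Infty: "jac_point f Infty = \<one>\<^bsub>jacobian f\<^esub>"
  by (simp add: jac_point_def jacobian_one)

lemma jac_point_carrier: "P \<in> curve f \<Longrightarrow> jac_point f P \<in> carrier (jacobian f)"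
  unfolding jac_point_def carrier_jacobian using keys_point_minus divisor_degree_point_minus by blast

lemma doubling_class:
  assumes "Poly_Mapping.keys D \<subseteq> curve f" "divisor_class f D \<in> carrier (jacobian f)"
  shows "doubling f (divisor_class f D) = divisor_class f (D + D)"
proof -
  interpret comm_group "jacobian f" by (rule jacobian_group)
  show ?thesis unfolding doubling_def using assms jacobian_mult[of D D] by (simp add: numeral_2_eq_2)
qed

text \<open>Supplies an explicit divisor for a point of \<open>Theta\<close>. The support condition
  is carried through the induction because \<open>jacobian_mult\<close> asks for it.\<close>

lemma finprod_jac_points:
  assumes "finite A" "Q \<in> A \<rightarrow> curve f"
  defines "D \<equiv> (\<Sum>i\<in>A. frag_of (Q i) - frag_of Infty)"
  shows "Poly_Mapping.keys D \<subseteq> curve f \<and> (\<Otimes>\<^bsub>jacobian f\<^esub>i\<in>A. jac_point f (Q i)) = divisor_class f D"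
  using assms(1,2) unfolding D_def
proof (induction A)
  case empty
  interpret comm_group "jacobian f" by (rule jacobian_group)
  show ?case by (simp add: jacobian_one)
next
  case (insert i A)
  interpret comm_group "jacobian f" by (rule jacobian_group)
  define D where "D = (\<Sum>i\<in>A. frag_of (Q i) - frag_of Infty)"
  have Qi: "Q i \<in> curve f" and QA: "Q \<in> A \<rightarrow> curve f" using insert.prems by auto
  have IH: "Poly_Mapping.keys D \<subseteq> curve f" "(\<Otimes>\<^bsub>jacobian f\<^esub>i\<in>A. jac_point f (Q i)) = divisor_class f D"
    using insert.IH[OF QA] unfolding D_def by blast+
  have sum: "(\<Sum>i\<in>insert i A. frag_of (Q i) - frag_of Infty) = (frag_of (Q i) - frag_of Infty) + D"
    using insert.hyps by (simp add: D_def)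
  have "Poly_Mapping.keys ((frag_of (Q i) - frag_of Infty) + D) \<subseteq> curve f"
    using keys_add[of "frag_of (Q i) - frag_of Infty" D] keys_point_minus[OF Qi] IH(1) by blast
  moreover have "(\<Otimes>\<^bsub>jacobian f\<^esub>i\<in>insert i A. jac_point f (Q i))
      = jac_point f (Q i) \<otimes>\<^bsub>jacobian f\<^esub> (\<Otimes>\<^bsub>jacobian f\<^esub>i\<in>A. jac_point f (Q i))"
    using insert.hyps QA Qi jac_point_carrier by (intro finprod_insert) auto
  ultimately show ?case
    unfolding sum IH(2) using jacobian_mult[OF keys_point_minus[OF Qi] IH(1)]
    by (simp add: jac_point_def[of f "Q i"])
qed

lemma Theta_subset_carrier: "Theta f d \<subseteq> carrier (jacobian f)"
proof -
  interpret comm_group "jacobian f" by (rule jacobian_group)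
  show ?thesis unfolding Theta_def using jac_point_carrier by (auto intro!: finprod_closed)
qed

lemma one_in_Theta: "\<one>\<^bsub>jacobian f\<^esub> \<in> Theta f d"
proof -
  interpret comm_group "jacobian f" by (rule jacobian_group)
  have "(\<Otimes>\<^bsub>jacobian f\<^esub>i\<in>{1..d}. jac_point f Infty) = \<one>\<^bsub>jacobian f\<^esub>"
    unfolding jac_point_Infty by simp
  then show ?thesis unfolding Theta_def by (intro CollectI exI[of _ "\<lambda>_. Infty"]) auto
qed

text \<open>The point is padded with copies of \<open>Infty\<close>, the zero of the jacobian. This
  reduces the claim on the curve and \<open>half_curve\<close> to the one on
  \<open>Theta\<close>.\<close>

lemma jac_curve_subset_Theta:
  assumes "d \<ge> 1"
  shows "jac_curve f \<subseteq> Theta f d"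
proof
  interpret comm_group "jacobian f" by (rule jacobian_group)
  fix x assume "x \<in> jac_curve f"
  then obtain P where P: "P \<in> curve f" "x = jac_point f P" by (auto simp: jac_curve_def)
  define Q where "Q = (\<lambda>i::nat. if i = 1 then P else Infty)"
  have "{1..d} = insert 1 {2..d}" using assms by auto
  then have "(\<Otimes>\<^bsub>jacobian f\<^esub>i\<in>{1..d}. jac_point f (Q i))
      = jac_point f (Q 1) \<otimes>\<^bsub>jacobian f\<^esub> (\<Otimes>\<^bsub>jacobian f\<^esub>i\<in>{2..d}. jac_point f (Q i))"
    using P jac_point_carrier by (simp only:) (intro finprod_insert, auto simp: Q_def)
  also have "(\<Otimes>\<^bsub>jacobian f\<^esub>i\<in>{2..d}. jac_point f (Q i)) = \<one>\<^bsub>jacobian f\<^esub>"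
    by (rule finprod_one_eqI) (simp add: Q_def jac_point_Infty)
  finally have "x = (\<Otimes>\<^bsub>jacobian f\<^esub>i\<in>{1..d}. jac_point f (Q i))"
    using P jac_point_carrier by (simp add: Q_def)
  moreover have "Q \<in> {1..d} \<rightarrow> curve f" using P by (simp add: Q_def)
  ultimately show "x \<in> Theta f d" unfolding Theta_def by blast
qed

lemma doubling_Theta_in_curve:
  assumes d: "2 * d + 1 < degree f" and Q: "Q \<in> Theta f d" "doubling f Q \<in> jac_curve f"
  shows "doubling f Q = \<one>\<^bsub>jacobian f\<^esub>"
proof -
  obtain R where R: "R \<in> {1..d} \<rightarrow> curve f" "Q = (\<Otimes>\<^bsub>jacobian f\<^esub>i\<in>{1..d}. jac_point f (R i))"
    using Q(1) by (auto simp: Theta_def)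
  define D where "D = (\<Sum>i\<in>{1..d}. frag_of (R i) - frag_of Infty)"
  have D: "Poly_Mapping.keys D \<subseteq> curve f" "Q = divisor_class f D"
    using finprod_jac_points[OF _ R(1)] R(2) by (auto simp: D_def)
  have DD: "Poly_Mapping.keys (D + D) \<subseteq> curve f" using keys_add[of D D] D(1) by blast
  have dbl: "doubling f Q = divisor_class f (D + D)"
    using doubling_class D Q(1) Theta_subset_carrier by blast
  obtain P where P: "P \<in> curve f" "doubling f Q = jac_point f P"
    using Q(2) by (auto simp: jac_curve_def)
  show ?thesis
  proof (cases P)
    case Infty
    then show ?thesis using P(2) jac_point_Infty by simp
  next
    case (Aff a b)
    have "D + D - (frag_of P - frag_of Infty) \<in> principal_divisors f"
      using dbl P(2) divisor_class_eq_iff[OF DD keys_point_minus[OF P(1)]] by (simp add: jac_point_def)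
    then obtain h where h: "h \<noteq> (0, 0)"
      "\<forall>S\<in>curve f. Poly_Mapping.lookup (D + D - (frag_of P - frag_of Infty)) S = ord_at f S h"
      unfolding principal_iff by blast
    \<comment> \<open>The multiplicity of \<open>S\<close> among the summands. Some summands may be
      \<open>Infty\<close>, so the order at infinity also contains \<open>m Infty\<close>.\<close>
    define m where "m S = card {i\<in>{1..d}. R i = S}" for S
    have m: "Poly_Mapping.lookup D S = int (m S) - (if S = Infty then int d else 0)" for S
    proof -
      have "Poly_Mapping.lookup D S = (\<Sum>i\<in>{1..d}. (if R i = S then 1 else 0)) - (\<Sum>i\<in>{1..d}. if S = Infty then 1 else 0)"
        unfolding D_def lookup_sum lookup_minus lookup_frag_of
        by (auto simp: sum_subtractf when_def intro!: sum.cong)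
      then show ?thesis by (simp add: m_def sum.If_cases Int_def)
    qed
    have ordh: "ord_at f S h = 2 * int (m S) - (if S = Infty then 2 * int d else 0)
        - ((if S = P then 1 else 0) - (if S = Infty then 1 else 0))" if "S \<in> curve f" for S
      using h(2)[rule_format, OF that, symmetric] m[of S]
      by (auto simp: lookup_minus lookup_add when_def)
    have False
    proof (rule no_function_halving_point[of a b h m])
      show "Aff a b \<in> curve f" using P Aff by simp
      show "h \<noteq> (0, 0)" by fact
      show "ord_at f (Aff c e) h = 2 * int (m (Aff c e)) - (if Aff c e = Aff a b then 1 else 0)"
        if "Aff c e \<in> curve f" for c e
        using ordh[OF that] Aff by simp
      \<comment> \<open>The order at infinity is \<open>2 m - 2 d + 1\<close>, at least
        \<open>1 - 2 d\<close>; the hypothesis \<open>d\<close> is exactly what places this above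
        \<open>2 - degree f\<close>.\<close>
      show "2 - int (degree f) < ord_at f Infty h"
        using ordh[of Infty] d Aff by simp
    qed
    then show ?thesis ..
  qed
qed

lemma ord_dvd_2_iff:
  assumes "Q \<in> carrier (jacobian f)"
  shows "group.ord (jacobian f) Q dvd 2 \<longleftrightarrow> doubling f Q = \<one>\<^bsub>jacobian f\<^esub>"
proof -
  interpret comm_group "jacobian f" by (rule jacobian_group)
  show ?thesis using pow_eq_id[OF assms, of 2] by (simp add: doubling_def)
qed

text \<open>The class is killed by 2 iff twice the point minus twice infinity is principal. The
  function \<open>x - a\<close> provides this at a branch point, and
  \<open>two_torsion_point_is_branch\<close> excludes other points.\<close>

lemma doubling_jac_point_iff:
  assumes "degree f > 2" "Aff a b \<in> curve f"
  shows "doubling f (jac_point f (Aff a b)) = \<one>\<^bsub>jacobian f\<^esub> \<longleftrightarrow> b = 0"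
proof -
  define D where "D = frag_of (Aff a b) - frag_of Infty"
  have D: "Poly_Mapping.keys D \<subseteq> curve f" unfolding D_def using assms(2) by (rule keys_point_minus)
  have DD: "Poly_Mapping.keys (D + D) \<subseteq> curve f" using keys_add[of D D] D by blast
  have "doubling f (jac_point f (Aff a b)) = divisor_class f (D + D)"
    using doubling_class[OF D] jac_point_carrier[OF assms(2)] by (simp add: jac_point_def D_def)
  then have iff: "doubling f (jac_point f (Aff a b)) = \<one>\<^bsub>jacobian f\<^esub> \<longleftrightarrow> D + D \<in> principal_divisors f"
    unfolding jacobian_one using divisor_class_eq_iff[OF DD, of 0] by simp
  have lookup: "Poly_Mapping.lookup (D + D) S = (if S = Aff a b then 2 else if S = Infty then - 2 else 0)" for S
    by (auto simp: D_def lookup_add lookup_minus when_def)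
  show ?thesis
  proof
    assume "doubling f (jac_point f (Aff a b)) = \<one>\<^bsub>jacobian f\<^esub>"
    then obtain h where h: "h \<noteq> (0, 0)" "\<And>S. S \<in> curve f \<Longrightarrow> Poly_Mapping.lookup (D + D) S = ord_at f S h"
      unfolding iff principal_iff by blast
    show "b = 0"
    proof (rule two_torsion_point_is_branch[OF assms(2) h(1)])
      show "ord_at f (Aff c d) h = (if Aff c d = Aff a b then 2 else 0)" if "Aff c d \<in> curve f" for c d
        using h(2)[OF that] unfolding lookup by (auto split: if_splits)
      \<comment> \<open>The order at infinity is \<open>- 2\<close>, so the degree has to exceed
        2.\<close>
      show "- int (degree f) < ord_at f Infty h"
        using h(2)[of Infty] lookup[of Infty] assms(1) by simp
    qed
  next
    assume "b = 0"
    then have "D + D \<in> principal_divisors f"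
      unfolding principal_iff lookup using DD assms(2) ord_at_linear[of a]
      by (intro conjI exI[of _ "(to_fract [:-a, 1:], 0)"]) auto
    then show "doubling f (jac_point f (Aff a b)) = \<one>\<^bsub>jacobian f\<^esub>" using iff by blast
  qed
qed

end

section \<open>The theorem for a product of distinct linear factors\<close>

lemma prod_linear_factors:
  fixes \<alpha> :: "'b \<Rightarrow> 'a::field"
  assumes "finite I" "inj_on \<alpha> I"
  defines "f \<equiv> (\<Prod>i\<in>I. [:- \<alpha> i, 1:])"
  shows "degree f = card I" "poly f a = 0 \<longleftrightarrow> a \<in> \<alpha> ` I" "a \<in> \<alpha> ` I \<Longrightarrow> Polynomial.order a f = 1"
proof -
  show "degree f = card I" unfolding f_def by (subst degree_prod_eq_sum_degree) auto
  show "poly f a = 0 \<longleftrightarrow> a \<in> \<alpha> ` I" using assms(1) by (auto simp: f_def poly_prod)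
  assume "a \<in> \<alpha> ` I"
  then obtain i where i: "i \<in> I" "a = \<alpha> i" by blast
  define r where "r = (\<Prod>j\<in>I - {i}. [:- \<alpha> j, 1:])"
  have f: "f = [:-a, 1:] * r" unfolding f_def r_def i(2) by (rule prod.remove[OF assms(1) i(1)])
  have "poly r a \<noteq> 0" using assms(1,2) i by (auto simp: r_def poly_prod inj_on_def)
  then have "Polynomial.order a r = 0" "r \<noteq> 0" by (auto simp: order_0I)
  moreover from this have "[:-a, 1:] * r \<noteq> 0" by (simp only: mult_eq_0_iff) simp
  ultimately show "Polynomial.order a f = 1"
    unfolding f by (simp only: order_mult order_linear add_0_right not_False_eq_True)
qed

theorem theorem2p5:
  fixes \<alpha> :: "nat \<Rightarrow> 'a::alg_closed_field"
    and g :: nat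
    and f :: "'a poly"
  assumes "CHAR('a) \<noteq> 2"
    and "g > 1"
    and "inj_on \<alpha> {1..2 * g + 1}"
    and "f = (\<Prod>i=1..2 * g + 1. [:- \<alpha> i, 1:])"
  shows "(\<forall>Q \<in> half_curve f \<inter> Theta f (g - 1). group.ord (jacobian f) Q dvd 2) \<and>
         jac_curve f \<inter> half_curve f =
           insert (jac_point f Infty) {jac_point f (Aff (\<alpha> i) 0) | i. 1 \<le> i \<and> i \<le> 2 * g + 1} \<and>
         jac_curve f \<inter> doubling f ` Theta f (g - 1) = {\<one>\<^bsub>jacobian f\<^esub>}"
proof -
  note lin = prod_linear_factors[OF _ assms(3), folded assms(4)]
  have deg: "degree f = 2 * g + 1" using lin(1) by simp
  have "(2::'a) \<noteq> 0"
  proof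
    assume "(2::'a) = 0"
    then have "CHAR('a) dvd 2" using of_nat_eq_0_iff_char_dvd[of 2, where 'a = 'a] by simp
    then have "CHAR('a) = 1 \<or> CHAR('a) = 2" using two_is_prime_nat prime_nat_iff by blast
    then show False using assms(1) by simp
  qed
  then interpret odd_curve f
    using lin(2,3) deg by unfold_locales auto
  interpret J: comm_group "jacobian f" by (rule jacobian_group)
  have one_curve: "\<one>\<^bsub>jacobian f\<^esub> \<in> jac_curve f"
    unfolding jac_curve_def jac_point_Infty[symmetric] by simp
  have dbl1: "doubling f \<one>\<^bsub>jacobian f\<^esub> = \<one>\<^bsub>jacobian f\<^esub>" by (simp add: doubling_def)
  have main: "doubling f Q = \<one>\<^bsub>jacobian f\<^esub>" if "Q \<in> Theta f (g - 1)" "doubling f Q \<in> jac_curve f" for Q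
    using doubling_Theta_in_curve[OF _ that] deg assms(2) by simp
  have "group.ord (jacobian f) Q dvd 2" if "Q \<in> half_curve f \<inter> Theta f (g - 1)" for Q
    using that main ord_dvd_2_iff by (auto simp: half_curve_def)
  moreover have "jac_curve f \<inter> half_curve f =
      insert (jac_point f Infty) {jac_point f (Aff (\<alpha> i) 0) | i. 1 \<le> i \<and> i \<le> 2 * g + 1}"
  proof -
    \<comment> \<open>As \<open>g - 1\<close> is at least 1, the curve lies in
      \<open>Theta f (g - 1)\<close> and \<open>main\<close> applies to its points; conversely, a
      double equal to zero lies on the curve because zero does.\<close>
    have "jac_curve f \<inter> half_curve f = {x \<in> jac_curve f. doubling f x = \<one>\<^bsub>jacobian f\<^esub>}"
      using main jac_curve_subset_Theta[of "g - 1"] assms(2) one_curve Theta_subset_carrier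
      unfolding half_curve_def by fastforce
    also have "\<dots> = jac_point f ` {P \<in> curve f. doubling f (jac_point f P) = \<one>\<^bsub>jacobian f\<^esub>}"
      by (auto simp: jac_curve_def)
    also have "{P \<in> curve f. doubling f (jac_point f P) = \<one>\<^bsub>jacobian f\<^esub>}
        = insert Infty ((\<lambda>i. Aff (\<alpha> i) 0) ` {1..2 * g + 1})"
    proof (rule Set.set_eqI)
      fix P
      show "P \<in> {P \<in> curve f. doubling f (jac_point f P) = \<one>\<^bsub>jacobian f\<^esub>} \<longleftrightarrow>
          P \<in> insert Infty ((\<lambda>i. Aff (\<alpha> i) 0) ` {1..2 * g + 1})"
      proof (cases P)
        case Infty
        then show ?thesis using dbl1 by (simp add: jac_point_Infty)
      next
        case (Aff a b)
        then show ?thesis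
          using doubling_jac_point_iff[of a b] deg assms(2) lin(2)[of a] by auto
      qed
    qed
    also have "jac_point f ` \<dots> = insert (jac_point f Infty) {jac_point f (Aff (\<alpha> i) 0) | i. 1 \<le> i \<and> i \<le> 2 * g + 1}"
      by auto
    finally show ?thesis .
  qed
  moreover have "jac_curve f \<inter> doubling f ` Theta f (g - 1) = {\<one>\<^bsub>jacobian f\<^esub>}"
  proof -
    \<comment> \<open>Zero is the double of zero, which is the sum of copies of
      \<open>Infty\<close>.\<close>
    have "\<one>\<^bsub>jacobian f\<^esub> \<in> doubling f ` Theta f (g - 1)"
      using one_in_Theta dbl1 by (metis image_eqI)
    then show ?thesis using main one_curve by auto
  qed
  ultimately show ?thesis by blast
qed

end
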